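(* Let $f=u+iv$ be analytic in the open unit disc $|z|<1$ with $f(0)=0$, where $u=\Re f$, $v=\Im f$. Suppose that there are constants $H,K>0$ with $u(z)\le H$ and $\frac{\partial v}{\partial\theta}(z)\le K$ for all $|z|<1$. Then $$|v(z_1)-v(z_2)|\le\sqrt{2\pi}\,\sqrt{HK}\quad\text{for all }|z_1|,|z_2|<1.$$ Moreover $\sqrt{2\pi}$ is sharp: for every $c<\sqrt{2\pi}$ there exist such $f,H,K$ and points $|z_1|,|z_2|<1$ with $|v(z_1)-v(z_2)|>c\sqrt{HK}$.
   Context: Polar coordinates are normalized as $z=re^{2\pi i\theta}$ with $\theta\in[0,1)$, and $\frac{\partial v}{\partial\theta}$ is the derivative of $v(re^{2\pi i\theta})$ with respect to $\theta$. *)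

theory Defs
  imports "HOL-Analysis.Analysis"
begin

definition dv_dtheta :: "(complex \<Rightarrow> complex) \<Rightarrow> real \<Rightarrow> real \<Rightarrow> real" where
  "dv_dtheta f r \<theta> = deriv (\<lambda>t. Im (f (complex_of_real r * cis (2 * pi * t)))) \<theta>"

definition admissible :: "(complex \<Rightarrow> complex) \<Rightarrow> real \<Rightarrow> real \<Rightarrow> bool" where
  "admissible f H K \<longleftrightarrow>
     f holomorphic_on ball 0 1 \<and> f 0 = 0 \<and> H > 0 \<and> K > 0 \<and>
     (\<forall>z. norm z < 1 \<longrightarrow> Re (f z) \<le> H) \<and>
     (\<forall>r \<theta>. 0 \<le> r \<and> r < 1 \<and> 0 \<le> \<theta> \<and> \<theta> < 1 \<longrightarrow> dv_dtheta f r \<theta> \<le> K)"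

end

theory Submission
  imports Defs "HOL-Complex_Analysis.Complex_Analysis"
begin

text \<open>
  Upper bound. By the maximum principle it suffices to bound the drop of \<open>v\<close> along an arc of a circle
  \<open>\<bar>z\<bar> = r\<close>, say between the angles \<open>0\<close> and \<open>b\<close>. Put \<open>g w = f (r * exp (2 * pi * \<i> * w))\<close>, which is
  bounded and holomorphic on the closed upper half plane. Let \<open>\<Phi>\<close> be the 1-periodic function that equals 1 on the arc
  and falls off as \<open>sqrt (1 - (d / L)\<^sup>2)\<close> at distance \<open>d\<close> from it. Writing \<open>P\<^sub>t\<close> for Poisson averaging at
  height \<open>t\<close>, one has \<open>\<Phi> - P\<^sub>t \<Phi> \<le> t / L\<close>. Since \<open>P\<^sub>t\<close> is self-adjoint and \<open>Re g\<close> has mean zero and is at most \<open>H\<close>,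
  the integral of \<open>\<Phi> * Re g\<close> at height \<open>t\<close> exceeds that at height 0 by at most \<open>t * H / L\<close>.
  Letting \<open>t\<close> tend to 0 and using the Cauchy-Riemann equations, the integral of \<open>- \<Phi> * v'\<close> is at most \<open>H / L\<close>;
  with \<open>v' \<le> K\<close> this gives a drop of at most \<open>H / L + pi * L * K / 2\<close>, and the best \<open>L\<close> yields the constant.

  Sharpness. With \<open>Q = s * (1 + z) / (1 - z)\<close> and \<open>S = sqrt (1 + Q\<^sup>2)\<close>, take
  \<open>f = (s / pi) * (Q / (1 + S) - Ln (Q + S))\<close>, normalised at 0. Then \<open>H = s\<^sup>2 / (2 * pi)\<close> and
  \<open>K = 1 + s\<^sup>2\<close> are admissible while \<open>v\<close> oscillates by \<open>s\<close>; let \<open>s\<close> tend to 0.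
\<close>

section \<open>Poisson averages on the half plane\<close>

text \<open>The Cayley map carries the disc into the right half plane. It serves twice: to transport
  the mean value property to the half plane, and to build the extremal functions.\<close>

lemma Re_cayley_pos:
  assumes "norm z < 1"
  shows "Re ((1 + z) / (1 - z)) > 0"
proof -
  have "1 - z \<noteq> 0" using assms by auto
  then have "(norm (1 - z))\<^sup>2 > 0" by simp
  moreover have "(norm z)\<^sup>2 < 1" using assms by (simp add: power_less_one_iff)
  moreover have "Re ((1 + z) / (1 - z)) = (1 - (norm z)\<^sup>2) / (norm (1 - z))\<^sup>2"
    by (simp add: Re_divide cmod_power2) (simp add: power2_eq_square algebra_simps)
  ultimately show ?thesis by simp
qed

lemma circle_mean_value:
  assumes f: "f holomorphic_on ball 0 1" and \<rho>: "0 < \<rho>" "\<rho> < 1"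
  shows "((\<lambda>x. f (of_real \<rho> * cis (2 * pi * x))) has_integral f 0) {0..1}"
proof -
  have "f holomorphic_on cball 0 \<rho>"
    using f by (rule holomorphic_on_subset) (use \<rho> in auto)
  then have "((\<lambda>u. f u / (u - 0)) has_contour_integral (2 * of_real pi * \<i> * f 0)) (circlepath 0 \<rho>)"
    by (rule Cauchy_integral_circlepath_simple) (use \<rho> in auto)
  then have "((\<lambda>x. f (circlepath 0 \<rho> x) / circlepath 0 \<rho> x * vector_derivative (circlepath 0 \<rho>) (at x within {0..1}))
      has_integral 2 * of_real pi * \<i> * f 0) {0..1}"
    by (simp add: has_contour_integral_def)
  then have "((\<lambda>x. 2 * of_real pi * \<i> * f (of_real \<rho> * cis (2 * pi * x))) has_integral 2 * of_real pi * \<i> * f 0) {0..1}"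
  proof (rule has_integral_eq[rotated])
    fix x :: real assume "x \<in> {0..1}"
    moreover have "exp (2 * of_real pi * \<i> * of_real x) = cis (2 * pi * x)"
      by (simp add: cis_conv_exp mult_ac)
    ultimately show "f (circlepath 0 \<rho> x) / circlepath 0 \<rho> x * vector_derivative (circlepath 0 \<rho>) (at x within {0..1})
      = 2 * of_real pi * \<i> * f (of_real \<rho> * cis (2 * pi * x))"
      using \<rho> by (simp add: vector_derivative_circlepath01) (simp add: circlepath)
  qed
  from has_integral_mult_right[OF this, of "inverse (2 * of_real pi * \<i>)"] show ?thesis
    by (simp add: field_simps)
qed

text \<open>The standard Cauchy distribution. Integrating a function of \<open>x + t * s\<close> against it is Poisson
  averaging at height \<open>t\<close>; its mass is pulled back from the unit circle, so no improper integral
  over the line is needed.\<close>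

definition cauchy_measure :: "real measure" where
  "cauchy_measure = distr (restrict_space lborel {0<..<1}) borel (\<lambda>y. - cot (pi * y))"

lemma cot_pi_measurable [measurable]: "(\<lambda>y::real. - cot (pi * y)) \<in> borel_measurable borel"
  unfolding cot_def by measurable

lemma cot_pi_measurable_restrict [measurable]:
  "(\<lambda>y::real. - cot (pi * y)) \<in> borel_measurable (restrict_space lborel {0<..<1})"
  using cot_pi_measurable by (intro measurable_restrict_space1) (simp only: measurable_lborel2)

lemma sets_cauchy_measure [measurable_cong, simp]: "sets cauchy_measure = sets borel"
  by (simp add: cauchy_measure_def)

lemma space_cauchy_measure [simp]: "space cauchy_measure = UNIV"
  by (simp add: cauchy_measure_def)

lemma emeasure_cauchy_measure: "emeasure cauchy_measure UNIV = 1"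
  unfolding cauchy_measure_def
  by (subst emeasure_distr[OF cot_pi_measurable_restrict]) (auto simp: emeasure_restrict_space space_restrict_space)

lemma measure_cauchy_measure [simp]: "measure cauchy_measure UNIV = 1"
  by (simp add: measure_def emeasure_cauchy_measure)

interpretation cauchy: finite_measure cauchy_measure
  by standard (simp add: emeasure_cauchy_measure)

lemma integrable_cauchy:
  fixes g :: "real \<Rightarrow> 'a :: {banach, second_countable_topology}"
  assumes "continuous_on UNIV g" "\<And>s. norm (g s) \<le> B"
  shows "integrable cauchy_measure g"
proof (rule cauchy.integrable_const_bound)
  have "g \<in> borel_measurable borel"
    by (intro borel_measurable_continuous_onI assms)
  then show "g \<in> borel_measurable cauchy_measure" by simp
qed (use assms in auto)

text \<open>The Cayley-type map \<open>C\<close> sends 0 to x + i t, and the circle point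
  \<open>cis (2 * pi * y)\<close> to x - t cot(pi y), which is the parametrisation behind
  \<open>cauchy_measure\<close>. The mean value property of \<open>F\<close> on circles of radius
  \<open>\<rho> n\<close>, with \<open>\<rho> n\<close> tending to 1 and the bound \<open>B\<close>
  dominating, gives the formula.\<close>

lemma poisson_half_plane:
  fixes G :: "complex \<Rightarrow> complex"
  assumes hol: "G holomorphic_on {w. Im w > 0}" and cont: "continuous_on {w. Im w \<ge> 0} G"
    and bound: "\<And>w. Im w \<ge> 0 \<Longrightarrow> norm (G w) \<le> B" and "t > 0"
  shows "(\<integral>s. G (of_real (x + t * s)) \<partial>cauchy_measure) = G (Complex x t)"
proof -
  let ?M = "restrict_space lborel {0<..<1::real}"
  define C where "C \<zeta> = of_real x + \<i> * of_real t * ((1 + \<zeta>) / (1 - \<zeta>))" for \<zeta>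
  have Im_C: "Im (C \<zeta>) = t * Re ((1 + \<zeta>) / (1 - \<zeta>))" for \<zeta>
  proof -
    have "C \<zeta> = of_real x + of_real t * (\<i> * ((1 + \<zeta>) / (1 - \<zeta>)))"
      by (simp add: C_def)
    then show ?thesis by (simp del: times_divide_eq_right)
  qed
  have Im_C_pos: "Im (C \<zeta>) > 0" if "norm \<zeta> < 1" for \<zeta>
    using Re_cayley_pos[OF that] \<open>t > 0\<close> by (simp add: Im_C)
  have C_bdry: "C (cis (2 * pi * y)) = of_real (x + t * - cot (pi * y))" if "0 < y" "y < 1" for y
  proof -
    define p where "p = pi * y"
    have sin: "sin p > 0" using that by (intro sin_gt_zero) (auto simp: p_def)
    have eq: "(1 + cis (2 * p)) = of_real (2 * cos p) * cis p" "(1 - cis (2 * p)) = - of_real (2 * sin p) * (\<i> * cis p)"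
      by (simp_all add: complex_eq_iff cos_double sin_double) (simp_all add: cos_squared_eq power2_eq_square algebra_simps)
    have "(1 + cis (2 * p)) / (1 - cis (2 * p)) = \<i> * of_real (cot p)"
      unfolding eq cot_def using sin by (simp add: divide_simps)
    then have "C (cis (2 * p)) = of_real x + \<i> * of_real t * (\<i> * of_real (cot p))"
      unfolding C_def by (simp only:)
    also have "\<dots> = of_real (x + t * - cot p)"
      by (simp add: complex_eq_iff)
    finally show ?thesis
      by (simp add: p_def mult.assoc)
  qed
  define \<rho> :: "nat \<Rightarrow> real" where "\<rho> n = 1 - 1 / (n + 2)" for n
  have \<rho>: "0 < \<rho> n" "\<rho> n < 1" for n by (auto simp: \<rho>_def field_simps)
  have \<rho>_lim: "\<rho> \<longlonglongrightarrow> 1"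
    unfolding \<rho>_def by real_asymp
  define F where "F \<zeta> = G (C \<zeta>)" for \<zeta>
  have hol_C: "C holomorphic_on ball 0 1"
    unfolding C_def[abs_def] by (auto intro!: holomorphic_intros)
  have hol_F: "F holomorphic_on ball 0 1"
  proof -
    have "C ` ball 0 1 \<subseteq> {w. Im w > 0}" using Im_C_pos by auto
    then show ?thesis
      unfolding F_def[abs_def] using holomorphic_on_compose_gen[OF hol_C hol] by (simp add: o_def)
  qed
  have nrm: "norm (of_real (\<rho> n) * cis (2 * pi * y)) < 1" for n y
    using \<rho>[of n] by (simp add: norm_mult)
  have cont_F: "continuous_on A (\<lambda>y. F (of_real (\<rho> n) * cis (2 * pi * y)))" for n A
    by (rule continuous_on_compose2[OF holomorphic_on_imp_continuous_on[OF hol_F]])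
       (use nrm in \<open>auto intro!: continuous_intros\<close>)
  have meas_F: "(\<lambda>y. F (of_real (\<rho> n) * cis (2 * pi * y))) \<in> borel_measurable ?M" for n
    by (intro measurable_restrict_space1) (simp add: borel_measurable_continuous_onI cont_F)
  have int_F: "(\<integral>y. F (of_real (\<rho> n) * cis (2 * pi * y)) \<partial>?M) = G (Complex x t)" for n
  proof -
    have int: "set_integrable lborel {0<..<1} (\<lambda>y. F (of_real (\<rho> n) * cis (2 * pi * y)))"
      by (rule set_integrable_subset[OF borel_integrable_atLeastAtMost'[of 0 1, OF cont_F]]) auto
    have "(\<integral>y. F (of_real (\<rho> n) * cis (2 * pi * y)) \<partial>?M) =
        (LINT y:{0<..<1}|lborel. F (of_real (\<rho> n) * cis (2 * pi * y)))"
      by (simp add: integral_restrict_space set_lebesgue_integral_def)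
    also have "\<dots> = integral {0<..<1} (\<lambda>y. F (of_real (\<rho> n) * cis (2 * pi * y)))"
      by (rule set_borel_integral_eq_integral(2)[OF int])
    also have "\<dots> = integral {0..1} (\<lambda>y. F (of_real (\<rho> n) * cis (2 * pi * y)))"
      using integral_open_interval[of "0::real" 1] by simp
    also have "\<dots> = F 0"
      by (rule integral_unique[OF circle_mean_value[OF hol_F \<rho>]])
    also have "\<dots> = G (Complex x t)"
      by (simp add: F_def C_def Complex_eq)
    finally show ?thesis .
  qed
  have meas_bdry: "(\<lambda>s. G (of_real (x + t * s))) \<in> borel_measurable borel"
    by (intro borel_measurable_continuous_onI continuous_on_compose2[OF cont] continuous_intros) auto
  have "(\<lambda>n. \<integral>y. F (of_real (\<rho> n) * cis (2 * pi * y)) \<partial>?M) \<longlonglongrightarrow> (\<integral>y. G (of_real (x + t * - cot (pi * y))) \<partial>?M)"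
  proof (rule integral_dominated_convergence[where w = "\<lambda>_. B"])
    show "(\<lambda>y. G (of_real (x + t * - cot (pi * y)))) \<in> borel_measurable ?M"
      using measurable_compose[OF cot_pi_measurable_restrict meas_bdry] by simp
    show "integrable ?M (\<lambda>_. B)"
      by (rule finite_measure.integrable_const) (simp add: finite_measure_restrict_space emeasure_restrict_space finite_measureI)
    show "AE y in ?M. (\<lambda>n. F (of_real (\<rho> n) * cis (2 * pi * y))) \<longlonglongrightarrow> G (of_real (x + t * - cot (pi * y)))"
    proof (rule AE_I2)
      fix y assume "y \<in> space ?M"
      then have y: "0 < y" "y < 1" by (auto simp: space_restrict_space)
      \<comment> \<open>The only singularity of \<open>C\<close> on the closed disc is the point 1,
        which corresponds to the excluded ends y = 0 and y = 1.\<close>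
      have ne: "cis (2 * pi * y) \<noteq> 1"
      proof
        assume "cis (2 * pi * y) = 1"
        then have "1 - 2 * (sin (pi * y))\<^sup>2 = 1"
          using cos_double_sin[of "pi * y"] by (simp add: complex_eq_iff mult.assoc)
        moreover have "sin (pi * y) > 0" using y by (intro sin_gt_zero) auto
        ultimately show False by simp
      qed
      have "(\<lambda>n. C (of_real (\<rho> n) * cis (2 * pi * y))) \<longlonglongrightarrow> C (of_real 1 * cis (2 * pi * y))"
        unfolding C_def using ne by (intro tendsto_intros \<rho>_lim) auto
      then have "(\<lambda>n. C (of_real (\<rho> n) * cis (2 * pi * y))) \<longlonglongrightarrow> of_real (x + t * - cot (pi * y))"
        using C_bdry[OF y] by simp
      then show "(\<lambda>n. F (of_real (\<rho> n) * cis (2 * pi * y))) \<longlonglongrightarrow> G (of_real (x + t * - cot (pi * y)))"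
        unfolding F_def
        by (rule continuous_on_tendsto_compose[OF cont])
           (auto intro!: always_eventually less_imp_le Im_C_pos nrm)
    qed
    show "AE y in ?M. norm (F (of_real (\<rho> n) * cis (2 * pi * y))) \<le> B" for n
      unfolding F_def by (intro AE_I2 bound less_imp_le Im_C_pos nrm)
  qed (rule meas_F)
  then have "(\<integral>y. G (of_real (x + t * - cot (pi * y))) \<partial>?M) = G (Complex x t)"
    unfolding int_F by (simp add: LIMSEQ_const_iff)
  moreover have "(\<integral>s. G (of_real (x + t * s)) \<partial>cauchy_measure) = (\<integral>y. G (of_real (x + t * - cot (pi * y))) \<partial>?M)"
    unfolding cauchy_measure_def by (rule integral_distr[OF cot_pi_measurable_restrict meas_bdry])
  ultimately show ?thesis by simp
qed

section \<open>Integration over one period and self-adjointness of averaging\<close>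

abbreviation unit_interval :: "real measure" where
  "unit_interval \<equiv> restrict_space lborel {0..1}"

lemma finite_measure_unit_interval: "finite_measure unit_interval"
  by (rule finite_measureI) (simp add: emeasure_restrict_space space_restrict_space)

text \<open>Fubini against \<open>cauchy_measure\<close> needs the Lebesgue integral, while shifts,
  Leibniz's rule and the fundamental theorem are applied to the gauge integral; this is the
  bridge.\<close>

lemma integral_unit_interval:
  fixes h :: "real \<Rightarrow> real"
  assumes "continuous_on UNIV h"
  shows "(\<integral>x. h x \<partial>unit_interval) = integral {0..1} h"
proof -
  have "set_integrable lborel {0..1} h"
    by (rule borel_integrable_atLeastAtMost'[OF continuous_on_subset[OF assms]]) auto
  from set_borel_integral_eq_integral(2)[OF this] show ?thesis
    by (simp add: integral_restrict_space set_lebesgue_integral_def)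
qed

lemma ident_measurable_unit_interval: "(\<lambda>x. x) \<in> borel_measurable unit_interval"
  by (intro measurable_restrict_space1) simp

lemma integrable_unit_interval:
  fixes h :: "real \<Rightarrow> real"
  assumes "continuous_on UNIV h" "\<And>x. \<bar>h x\<bar> \<le> B"
  shows "integrable unit_interval h"
proof (rule finite_measure.integrable_const_bound[OF finite_measure_unit_interval])
  show "h \<in> borel_measurable unit_interval"
    using measurable_compose[OF ident_measurable_unit_interval borel_measurable_continuous_onI[OF assms(1)]] .
qed (use assms in auto)

lemma periodic_of_int:
  fixes h :: "real \<Rightarrow> 'a"
  assumes "\<And>x. h (x + 1) = h x"
  shows "h (x + of_int k) = h x"
proof (induction k rule: int_induct[where k = 0])
  case (step1 i)
  then show ?case using assms[of "x + of_int i"] by (simp add: add_ac)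
next
  case (step2 i)
  then show ?case using assms[of "x + of_int (i - 1)"] by (simp add: add_ac)
qed simp

text \<open>Cut the interval from \<tau> to \<tau> + 1 at the integer \<open>k\<close> and move the
  left piece one period to the right; the result is a full period starting at an integer.\<close>

lemma integral_periodic_shift:
  fixes h :: "real \<Rightarrow> real"
  assumes cont: "continuous_on UNIV h" and per: "\<And>x. h (x + 1) = h x"
  shows "integral {0..1} (\<lambda>x. h (x + \<tau>)) = integral {0..1} h"
proof -
  define k where "k = \<lceil>\<tau>\<rceil>"
  have k: "\<tau> \<le> k" "k \<le> \<tau> + 1" unfolding k_def by linarith+
  have int: "h integrable_on {c..d}" for c d
    by (rule integrable_continuous_interval[OF continuous_on_subset[OF cont]]) auto
  have shift: "integral {c..d} (\<lambda>x. h (x + e)) = integral {c + e..d + e} h" for c d e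
    using integral_shift_real_ivl[of "c + e" e "d + e" h] by simp
  have "integral {0..1} (\<lambda>x. h (x + \<tau>)) = integral {\<tau>..\<tau> + 1} h"
    using shift[of 0 1 \<tau>] by (simp add: add.commute)
  also have "\<dots> = integral {\<tau>..k} h + integral {k..\<tau> + 1} h"
    by (rule Henstock_Kurzweil_Integration.integral_combine[symmetric]) (use k int in auto)
  also have "integral {\<tau>..k} h = integral {\<tau> + 1..k + 1} h"
    using shift[of \<tau> k 1] per by simp
  also have "integral {\<tau> + 1..k + 1} h + integral {k..\<tau> + 1} h = integral {k..k + 1} h"
    using Henstock_Kurzweil_Integration.integral_combine[of k "\<tau> + 1" "k + 1" h] k int by simp
  also have "\<dots> = integral {0..1} h"
    using shift[of 0 1 k] periodic_of_int[of h, OF per] by (simp add: add.commute)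
  finally show ?thesis .
qed

text \<open>For each fixed s, translating by t * s over a full period moves the shift from \<phi> to
  u with the opposite sign. Fubini, justified by boundedness on a finite product measure, integrates
  this over s.\<close>

lemma average_adjoint:
  fixes \<phi> u :: "real \<Rightarrow> real"
  assumes \<phi>: "continuous_on UNIV \<phi>" "\<And>x. \<phi> (x + 1) = \<phi> x" "\<And>x. \<bar>\<phi> x\<bar> \<le> B"
    and u: "continuous_on UNIV u" "\<And>x. u (x + 1) = u x" "\<And>x. \<bar>u x\<bar> \<le> C"
  shows "integrable unit_interval (\<lambda>x. (\<integral>s. \<phi> (x - t * s) \<partial>cauchy_measure) * u x)"
    and "(\<integral>x. (\<integral>s. \<phi> (x - t * s) \<partial>cauchy_measure) * u x \<partial>unit_interval) =
         (\<integral>x. \<phi> x * (\<integral>s. u (x + t * s) \<partial>cauchy_measure) \<partial>unit_interval)"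
proof -
  let ?N = "unit_interval \<Otimes>\<^sub>M cauchy_measure"
  interpret U: finite_measure unit_interval by (rule finite_measure_unit_interval)
  interpret P: pair_sigma_finite unit_interval cauchy_measure ..
  interpret N: finite_measure ?N
    by (intro finite_measure_pair_measure) unfold_locales
  have [measurable]: "\<phi> \<in> borel_measurable borel" "u \<in> borel_measurable borel"
    by (intro borel_measurable_continuous_onI \<phi> u)+
  have [measurable]: "(\<lambda>p. fst p) \<in> borel_measurable ?N" "(\<lambda>p. snd p) \<in> borel_measurable ?N"
    using measurable_compose[OF measurable_fst ident_measurable_unit_interval]
      measurable_snd[of unit_interval cauchy_measure] by simp_all
  have bound: "\<bar>\<phi> x * u y\<bar> \<le> B * C" for x y
    unfolding abs_mult using \<phi>(3) u(3) order_trans[OF abs_ge_zero \<phi>(3)] by (intro mult_mono) auto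
  have i1: "integrable ?N (\<lambda>p. \<phi> (fst p - t * snd p) * u (fst p))"
    by (rule N.integrable_const_bound[where B = "B * C"]) (auto simp: bound)
  have i2: "integrable ?N (\<lambda>p. \<phi> (fst p) * u (fst p + t * snd p))"
    by (rule N.integrable_const_bound[where B = "B * C"]) (auto simp: bound)
  show "integrable unit_interval (\<lambda>x. (\<integral>s. \<phi> (x - t * s) \<partial>cauchy_measure) * u x)"
    using P.integrable_fst'[OF i1] by simp
  have "(\<integral>x. (\<integral>s. \<phi> (x - t * s) \<partial>cauchy_measure) * u x \<partial>unit_interval) =
      (\<integral>x. (\<integral>s. \<phi> (x - t * s) * u x \<partial>cauchy_measure) \<partial>unit_interval)"
    by simp
  also have "\<dots> = (\<integral>s. (\<integral>x. \<phi> (x - t * s) * u x \<partial>unit_interval) \<partial>cauchy_measure)"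
    by (rule P.Fubini_integral[symmetric]) (use i1 in \<open>simp add: case_prod_unfold\<close>)
  also have "\<dots> = (\<integral>s. (\<integral>x. \<phi> x * u (x + t * s) \<partial>unit_interval) \<partial>cauchy_measure)"
  proof (rule Bochner_Integration.integral_cong[OF refl])
    fix s
    have c: "continuous_on UNIV (\<lambda>x. \<phi> (x - t * s) * u x)" "continuous_on UNIV (\<lambda>x. \<phi> x * u (x + t * s))"
      by (intro continuous_intros continuous_on_compose2[OF \<phi>(1)] continuous_on_compose2[OF u(1)]; simp)+
    have "\<phi> (x + 1 - t * s) = \<phi> (x - t * s)" for x
      using \<phi>(2)[of "x - t * s"] by (simp add: algebra_simps)
    then have "integral {0..1} (\<lambda>x. \<phi> x * u (x + t * s)) = integral {0..1} (\<lambda>x. \<phi> (x - t * s) * u x)"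
      using integral_periodic_shift[OF c(1), of "t * s"] u(2) by simp
    then show "(\<integral>x. \<phi> (x - t * s) * u x \<partial>unit_interval) = (\<integral>x. \<phi> x * u (x + t * s) \<partial>unit_interval)"
      using c by (simp add: integral_unit_interval)
  qed
  also have "\<dots> = (\<integral>x. (\<integral>s. \<phi> x * u (x + t * s) \<partial>cauchy_measure) \<partial>unit_interval)"
    by (rule P.Fubini_integral) (use i2 in \<open>simp add: case_prod_unfold\<close>)
  finally show "(\<integral>x. (\<integral>s. \<phi> (x - t * s) \<partial>cauchy_measure) * u x \<partial>unit_interval) =
         (\<integral>x. \<phi> x * (\<integral>s. u (x + t * s) \<partial>cauchy_measure) \<partial>unit_interval)"
    by simp
qed

section \<open>Dome-shaped test functions\<close>

text \<open>The harmonic extension of \<open>dome\<close> to the upper half plane is the real part of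
  \<open>csqrt (1 - w\<^sup>2) + \<i> * w\<close>.\<close>

definition dome :: "real \<Rightarrow> real" where
  "dome x = sqrt (max 0 (1 - x\<^sup>2))"

lemma continuous_dome [continuous_intros]: "continuous_on A f \<Longrightarrow> continuous_on A (\<lambda>x. dome (f x))"
  unfolding dome_def by (intro continuous_intros)

lemma dome_nonneg: "0 \<le> dome x" and dome_le_1: "dome x \<le> 1"
  by (auto simp: dome_def)

lemma abs_dome_le: "\<bar>dome x\<bar> \<le> 1"
  using dome_nonneg[of x] dome_le_1[of x] by simp

lemma dome_antimono: "\<bar>x\<bar> \<le> \<bar>y\<bar> \<Longrightarrow> dome y \<le> dome x"
  unfolding dome_def by (auto simp: abs_le_square_iff)

text \<open>Averaging reproduces the harmonic extension, whose value at height t is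
  \<open>R c t - t\<close>. Since the modulus dominates the real part, \<open>R\<close> never drops
  below the boundary value \<open>dome c\<close>, so at most t is lost.\<close>

lemma dome_average_ge:
  assumes "t > 0"
  shows "(\<integral>s. dome (c + t * s) \<partial>cauchy_measure) \<ge> dome c - t"
proof -
  define R where "R x y = Re (csqrt (1 - (Complex x y)\<^sup>2))" for x y
  \<comment> \<open>This form is jointly continuous everywhere, including where \<open>csqrt\<close>
    itself jumps across its cut.\<close>
  have R_eq: "R x y = sqrt ((cmod (1 - (Complex x y)\<^sup>2) + (1 - x\<^sup>2 + y\<^sup>2)) / 2)" for x y
    by (simp add: R_def power2_eq_square)
  have R_0: "R x 0 = dome x" for x
  proof -
    have "1 - (Complex x 0)\<^sup>2 = of_real (1 - x\<^sup>2)"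
      by (simp add: complex_eq_iff power2_eq_square)
    then have "cmod (1 - (Complex x 0)\<^sup>2) = \<bar>1 - x\<^sup>2\<bar>"
      by (metis norm_of_real real_norm_def)
    then show ?thesis unfolding R_eq dome_def by (simp add: max_def abs_if)
  qed
  have R_ge: "R x y \<ge> dome x" for x y
  proof -
    define m where "m = cmod (1 - (Complex x y)\<^sup>2)"
    have "Re (1 - (Complex x y)\<^sup>2) = 1 - x\<^sup>2 + y\<^sup>2" by (simp add: power2_eq_square)
    then have "m \<ge> \<bar>1 - x\<^sup>2 + y\<^sup>2\<bar>"
      unfolding m_def using abs_Re_le_cmod by metis
    then have m: "0 \<le> m + (1 - x\<^sup>2 + y\<^sup>2)" "1 - x\<^sup>2 + y\<^sup>2 \<le> m"
      by auto
    have "1 - x\<^sup>2 + (1 - x\<^sup>2) \<le> m + (1 - x\<^sup>2 + y\<^sup>2)"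
      by (rule add_mono[OF order_trans[OF _ m(2)]]) auto
    with m(1) have "max 0 (1 - x\<^sup>2) \<le> (m + (1 - x\<^sup>2 + y\<^sup>2)) / 2"
      by (simp add: max_def)
    then show ?thesis
      unfolding R_eq dome_def m_def by (rule real_sqrt_le_mono)
  qed
  \<comment> \<open>On the real axis beyond 1 the square root meets its branch cut, so
    \<open>G\<close> is raised by \<epsilon> to be holomorphic near the closed half plane. Only the
    real part \<open>R\<close> has to survive the limit \<epsilon> to 0.\<close>
  define G where "G \<epsilon> w = csqrt (1 - (w + \<i> * of_real \<epsilon>)\<^sup>2) + \<i> * (w + \<i> * of_real \<epsilon>)" for \<epsilon> w
  have Re_G: "Re (G \<epsilon> (Complex x y)) = R x (y + \<epsilon>) - (y + \<epsilon>)" for \<epsilon> x y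
  proof -
    have "Complex x y + \<i> * of_real \<epsilon> = Complex x (y + \<epsilon>)" by (simp add: complex_eq_iff)
    then show ?thesis by (simp add: G_def R_def)
  qed
  have avg: "(\<integral>s. R (c + t * s) \<epsilon> - \<epsilon> \<partial>cauchy_measure) = R c (t + \<epsilon>) - (t + \<epsilon>)"
    and bnd: "\<And>x. \<bar>R x \<epsilon> - \<epsilon>\<bar> \<le> 1" if "\<epsilon> > 0" for \<epsilon>
  proof -
    have nonpos: "1 - w\<^sup>2 \<notin> \<real>\<^sub>\<le>\<^sub>0" if "Im w > 0" for w
    proof
      assume "1 - w\<^sup>2 \<in> \<real>\<^sub>\<le>\<^sub>0"
      then have "Re w * Im w = 0" "1 - (Re w)\<^sup>2 + (Im w)\<^sup>2 \<le> 0"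
        by (auto simp: complex_nonpos_Reals_iff power2_eq_square)
      then have "1 + (Im w)\<^sup>2 \<le> 0" using that by auto
      then show False using zero_le_power2[of "Im w"] by linarith
    qed
    have hol: "G \<epsilon> holomorphic_on {w. Im w \<ge> 0}"
      unfolding G_def[abs_def] using \<open>\<epsilon> > 0\<close> by (intro holomorphic_intros nonpos) auto
    \<comment> \<open>The relation S^2 + z^2 = 1 factors as (S + i z)(S - i z) = 1. The sign
      conditions on S and z make the first factor the smaller one, hence at most 1 in
      modulus.\<close>
    have G_bound: "norm (G \<epsilon> w) \<le> 1" if "Im w \<ge> 0" for w
    proof -
      define z where "z = w + \<i> * of_real \<epsilon>"
      define S where "S = csqrt (1 - z\<^sup>2)"
      have z: "Im z > 0" using that \<open>\<epsilon> > 0\<close> by (simp add: z_def)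
      have S: "S\<^sup>2 = 1 - z\<^sup>2" "Re S \<ge> 0"
        unfolding S_def by (rule power2_csqrt Re_csqrt)+
      have "Re S \<noteq> 0"
      proof
        assume "Re S = 0"
        then have "S\<^sup>2 = of_real (- (Im S)\<^sup>2)" by (simp add: complex_eq_iff power2_eq_square)
        also have "\<dots> \<in> \<real>\<^sub>\<le>\<^sub>0" by (simp only: nonpos_Reals_of_real_iff) simp
        finally show False using nonpos[OF z] S by simp
      qed
      with S have ReS: "Re S > 0" by simp
      have im: "Re S * Im S = - (Re z * Im z)"
        using S(1) by (auto simp: complex_eq_iff power2_eq_square mult.commute)
      have "Re z * Im S \<le> 0"
      proof -
        have "Re S * (Re z * Im S) = Re z * (Re S * Im S)"
          by simp
        also have "\<dots> = - ((Re z)\<^sup>2 * Im z)"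
          unfolding im by (simp add: power2_eq_square)
        also have "\<dots> \<le> 0" using z by simp
        finally show ?thesis using ReS by (simp add: mult_le_0_iff)
      qed
      moreover have "Re S * Im z \<ge> 0" using z S by simp
      ultimately have le: "norm (S + \<i> * z) \<le> norm (S - \<i> * z)"
        by (simp add: cmod_def power2_eq_square algebra_simps)
      have "(S + \<i> * z) * (S - \<i> * z) = 1"
        using S(1) by (simp add: algebra_simps power2_eq_square)
      then have "norm (S + \<i> * z) * norm (S - \<i> * z) = 1"
        by (metis norm_mult norm_one)
      with le have "norm (S + \<i> * z) * norm (S + \<i> * z) \<le> 1"
        by (metis mult_left_mono norm_ge_zero)
      then have "(norm (S + \<i> * z))\<^sup>2 \<le> 1"
        by (simp add: power2_eq_square)
      then show ?thesis
        by (simp add: G_def S_def z_def abs_square_le_1)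
    qed
    have cont: "continuous_on {w. Im w \<ge> 0} (G \<epsilon>)"
      by (rule holomorphic_on_imp_continuous_on[OF hol])
    have "(\<integral>s. G \<epsilon> (of_real (c + t * s)) \<partial>cauchy_measure) = G \<epsilon> (Complex c t)"
      by (rule poisson_half_plane[OF holomorphic_on_subset[OF hol] cont G_bound assms]) auto
    moreover have "integrable cauchy_measure (\<lambda>s. G \<epsilon> (of_real (c + t * s)))"
      by (rule integrable_cauchy[where B = 1])
         (auto intro!: G_bound continuous_on_compose2[OF cont] continuous_intros)
    then have "(\<integral>s. Re (G \<epsilon> (of_real (c + t * s))) \<partial>cauchy_measure)
        = Re (\<integral>s. G \<epsilon> (of_real (c + t * s)) \<partial>cauchy_measure)"
      by (rule integral_Re)
    moreover have "Re (G \<epsilon> (of_real x)) = R x \<epsilon> - \<epsilon>" for x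
      using Re_G[of \<epsilon> x 0] by (simp add: complex_of_real_def)
    ultimately show "(\<integral>s. R (c + t * s) \<epsilon> - \<epsilon> \<partial>cauchy_measure) = R c (t + \<epsilon>) - (t + \<epsilon>)"
      by (simp only: Re_G)
    show "\<bar>R x \<epsilon> - \<epsilon>\<bar> \<le> 1" for x
      using abs_Re_le_cmod[of "G \<epsilon> (Complex x 0)"] G_bound[of "Complex x 0"] Re_G[of \<epsilon> x 0] by simp
  qed
  have cont_R: "continuous_on UNIV (\<lambda>p. R (fst p) (snd p))"
    unfolding R_eq[abs_def] Complex_eq by (intro continuous_intros) auto
  define e :: "nat \<Rightarrow> real" where "e n = 1 / (n + 1)" for n
  have e: "e n > 0" for n by (simp add: e_def)
  have e_lim: "e \<longlonglongrightarrow> 0" unfolding e_def by real_asymp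
  have "(\<lambda>n. \<integral>s. R (c + t * s) (e n) - e n \<partial>cauchy_measure) \<longlonglongrightarrow> (\<integral>s. dome (c + t * s) \<partial>cauchy_measure)"
  proof (rule integral_dominated_convergence[where w = "\<lambda>_. 1"])
    show "(\<lambda>s. dome (c + t * s)) \<in> borel_measurable cauchy_measure"
      by (intro borel_measurable_integrable integrable_cauchy[where B = 1] continuous_intros)
         (simp add: abs_dome_le)
    show "(\<lambda>s. R (c + t * s) (e n) - e n) \<in> borel_measurable cauchy_measure" for n
    proof (intro borel_measurable_integrable integrable_cauchy[where B = 1])
      have "continuous_on UNIV (\<lambda>s. (c + t * s, e n))"
        by (intro continuous_intros)
      from continuous_on_compose2[OF cont_R this]
      show "continuous_on UNIV (\<lambda>s. R (c + t * s) (e n) - e n)"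
        by (intro continuous_on_diff continuous_on_const) simp
    qed (use bnd[OF e] in simp)
    show "AE s in cauchy_measure. (\<lambda>n. R (c + t * s) (e n) - e n) \<longlonglongrightarrow> dome (c + t * s)"
    proof (rule AE_I2)
      fix s
      have "(\<lambda>n. (c + t * s, e n)) \<longlonglongrightarrow> (c + t * s, 0)"
        by (intro tendsto_Pair tendsto_const e_lim)
      from continuous_on_tendsto_compose[OF cont_R this]
      have "(\<lambda>n. R (c + t * s) (e n)) \<longlonglongrightarrow> dome (c + t * s)"
        by (simp add: R_0)
      from tendsto_diff[OF this e_lim]
      show "(\<lambda>n. R (c + t * s) (e n) - e n) \<longlonglongrightarrow> dome (c + t * s)"
        by simp
    qed
  qed (use bnd e in auto)
  moreover have "(\<lambda>n. dome c - (t + e n)) \<longlonglongrightarrow> dome c - (t + 0)"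
    by (intro tendsto_intros e_lim)
  ultimately show ?thesis
    using avg[OF e] R_ge[of c] by (auto intro!: LIMSEQ_le[of "\<lambda>n. dome c - (t + e n)"])
qed

text \<open>The region under the graph lies in a quarter ellipse with semi-axes L and 1. Past L the
  dome vanishes, so replacing c by \<open>max c L\<close> reduces to the full quarter.\<close>

lemma integral_dome_le:
  assumes "L > 0" "c \<ge> 0"
  shows "integral {0..c} (\<lambda>x. dome (x / L)) \<le> pi * L / 4"
proof -
  have L: "L \<noteq> 0" using assms by simp
  define A where "A x = L * ((x / L) * sqrt (1 - (x / L)\<^sup>2) + arcsin (x / L)) / 2" for x
  have "((\<lambda>x. dome (x / L)) has_integral (A L - A 0)) {0..L}"
  \<comment> \<open>The arcsine and square root in \<open>A\<close> are not differentiable at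
    argument 1, so derivatives are taken only in the interior.\<close>
  proof (rule fundamental_theorem_of_calculus_interior)
    show "continuous_on {0..L} A"
      unfolding A_def
      by (intro continuous_intros ballI L) (use assms in \<open>auto intro: order_trans[of "-1" 0 "_ / _"]\<close>)
    fix x assume x: "x \<in> {0<..<L}"
    define y where "y = x / L"
    define q where "q = sqrt (1 - y\<^sup>2)"
    have y: "0 < y" "y < 1" "y\<^sup>2 < 1"
      using x assms by (auto simp: y_def power_less_one_iff)
    then have q: "q > 0" "q\<^sup>2 = 1 - y\<^sup>2" by (auto simp: q_def)
    have d1: "((\<lambda>x. x / L) has_real_derivative 1 / L) (at x)"
      using L by (auto intro!: derivative_eq_intros)
    have "((\<lambda>y. sqrt (1 - y\<^sup>2)) has_real_derivative - y / q) (at y)"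
      using y by (auto intro!: derivative_eq_intros simp: q_def field_simps)
    then have "((\<lambda>y. y * sqrt (1 - y\<^sup>2) + arcsin y) has_real_derivative 1 * q + - y / q * y + inverse q) (at y)"
      unfolding q_def using y by (intro DERIV_add DERIV_mult DERIV_ident DERIV_arcsin) auto
    also have "1 * q + - y / q * y + inverse q = 2 * q"
      using q by (simp add: field_simps power2_eq_square)
    finally have "((\<lambda>y. y * sqrt (1 - y\<^sup>2) + arcsin y) has_real_derivative 2 * q) (at (x / L))"
      by (simp add: y_def)
    from DERIV_cdivide[OF DERIV_cmult[OF DERIV_chain2[OF this d1]]]
    have "(A has_real_derivative L * (2 * q * (1 / L)) / 2) (at x)"
      unfolding A_def[abs_def] .
    moreover have "L * (2 * q * (1 / L)) / 2 = dome (x / L)"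
      using assms y by (simp add: dome_def q_def y_def)
    ultimately show "(A has_vector_derivative dome (x / L)) (at x)"
      by (simp add: has_real_derivative_iff_has_vector_derivative)
  qed (use assms in auto)
  then have i1: "integral {0..L} (\<lambda>x. dome (x / L)) = pi * L / 4"
    using assms by (simp add: A_def integral_unique)
  define m where "m = max c L"
  have cont: "(\<lambda>x. dome (x / L)) integrable_on {p..q}" for p q
    by (intro integrable_continuous_interval continuous_intros) (use assms in auto)
  have "integral {L..m} (\<lambda>x. dome (x / L)) = integral {L..m} (\<lambda>x. 0)"
    by (rule Henstock_Kurzweil_Integration.integral_cong)
       (use assms in \<open>auto simp: dome_def intro!: max_absorb1\<close>)
  then have "integral {0..m} (\<lambda>x. dome (x / L)) = pi * L / 4"
    using Henstock_Kurzweil_Integration.integral_combine[of 0 L m "\<lambda>x. dome (x / L)"] assms cont i1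
    by (simp add: m_def)
  moreover have "integral {0..c} (\<lambda>x. dome (x / L)) \<le> integral {0..m} (\<lambda>x. dome (x / L))"
    by (rule integral_subset_le) (use cont in \<open>auto simp: m_def dome_nonneg\<close>)
  ultimately show ?thesis by simp
qed

definition arcs :: "real \<Rightarrow> real set" where
  "arcs b = (\<Union>n\<in>\<int>. \<Union>c\<in>{0..b}. {n + c})"

definition arc_dome :: "real \<Rightarrow> real \<Rightarrow> real \<Rightarrow> real" where
  "arc_dome L b x = dome (infdist x (arcs b) / L)"

text \<open>Writing \<open>arcs\<close> as a sum of the closed set of integers and a compact
  interval makes closedness immediate. It guarantees a nearest point of \<open>arcs\<close> to every
  x.\<close>

lemma closed_arcs: "closed (arcs b)"
  unfolding arcs_def by (intro closed_compact_sums) auto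

lemma in_arcs_iff: "x \<in> arcs b \<longleftrightarrow> (\<exists>n::int. 0 \<le> x - of_int n \<and> x - of_int n \<le> b)"
proof
  assume "x \<in> arcs b"
  then obtain n :: int and c where "x = of_int n + c" "0 \<le> c" "c \<le> b"
    by (auto simp: arcs_def Ints_def)
  then show "\<exists>n::int. 0 \<le> x - of_int n \<and> x - of_int n \<le> b"
    by (intro exI[of _ n]) auto
next
  assume "\<exists>n::int. 0 \<le> x - of_int n \<and> x - of_int n \<le> b"
  then obtain n :: int where "0 \<le> x - of_int n" "x - of_int n \<le> b" by blast
  then have "of_int n \<in> (\<int> :: real set)" "x - of_int n \<in> {0..b}" "x = of_int n + (x - of_int n)"
    by auto
  then show "x \<in> arcs b" unfolding arcs_def by blast
qed

lemma arcs_nonempty: "0 \<le> b \<Longrightarrow> arcs b \<noteq> {}"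
  using in_arcs_iff[of 0 b] by (metis empty_iff diff_0_right of_int_0 order_refl)

lemma continuous_arc_dome: "L > 0 \<Longrightarrow> continuous_on UNIV (arc_dome L b)"
  unfolding arc_dome_def by (intro continuous_intros) auto

lemma abs_arc_dome_le: "\<bar>arc_dome L b x\<bar> \<le> 1"
  unfolding arc_dome_def by (rule abs_dome_le)

lemma arc_dome_nonneg: "0 \<le> arc_dome L b x"
  by (simp add: arc_dome_def dome_nonneg)

lemma arc_dome_periodic: "arc_dome L b (x + 1) = arc_dome L b x"
proof -
  have "arcs b = (+) 1 ` arcs b"
  proof (intro set_eqI iffI)
    fix y assume "y \<in> arcs b"
    then obtain n :: int where "0 \<le> y - of_int n \<and> y - of_int n \<le> b"
      by (auto simp: in_arcs_iff)
    then have "0 \<le> (y - 1) - of_int (n - 1) \<and> (y - 1) - of_int (n - 1) \<le> b" by simp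
    then have "y - 1 \<in> arcs b" unfolding in_arcs_iff by blast
    then show "y \<in> (+) 1 ` arcs b" by (intro image_eqI[of _ _ "y - 1"]) auto
  next
    fix y assume "y \<in> (+) 1 ` arcs b"
    then obtain n :: int where "0 \<le> (y - 1) - of_int n \<and> (y - 1) - of_int n \<le> b"
      by (auto simp: in_arcs_iff)
    then have "0 \<le> y - of_int (n + 1) \<and> y - of_int (n + 1) \<le> b" by auto
    then show "y \<in> arcs b" unfolding in_arcs_iff by blast
  qed
  then have "infdist (x + 1) (arcs b) = infdist (1 + x) ((+) 1 ` arcs b)"
    by (simp add: add.commute)
  also have "\<dots> = infdist x (arcs b)"
    by (simp add: infdist_def image_image)
  finally show ?thesis by (simp add: arc_dome_def)
qed

lemma arc_dome_ge_dome:
  assumes "L > 0" "c \<in> arcs b"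
  shows "arc_dome L b x \<ge> dome ((x - c) / L)"
  unfolding arc_dome_def
proof (rule dome_antimono)
  have "infdist x (arcs b) \<le> \<bar>x - c\<bar>"
    using infdist_le[OF assms(2), of x] by (simp add: dist_real_def)
  then show "\<bar>infdist x (arcs b) / L\<bar> \<le> \<bar>(x - c) / L\<bar>"
    using assms(1) infdist_nonneg[of x "arcs b"] by (simp add: divide_right_mono)
qed

lemma arc_dome_attained:
  assumes "0 \<le> b"
  obtains c where "c \<in> arcs b" "arc_dome L b x = dome ((x - c) / L)"
proof -
  obtain c where c: "c \<in> arcs b" "infdist x (arcs b) = dist x c"
    using infdist_attains_inf[OF closed_arcs arcs_nonempty[OF assms]] by metis
  then have "arc_dome L b x = dome ((x - c) / L)"
    by (simp add: arc_dome_def dist_real_def dome_def power_divide)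
  with c that show ?thesis by blast
qed

lemma arc_dome_eq_1:
  assumes "0 \<le> x" "x \<le> b"
  shows "arc_dome L b x = 1"
proof -
  have "0 \<le> x - of_int 0 \<and> x - of_int 0 \<le> b" using assms by simp
  then have "x \<in> arcs b" unfolding in_arcs_iff by blast
  then show ?thesis by (simp add: arc_dome_def dome_def)
qed

text \<open>\<open>arc_dome\<close> dominates a dome centred at a nearest point of the arcs and agrees with it at \<open>x\<close>,
  so positivity of the average transfers the bound for a single dome.\<close>

lemma arc_dome_average_ge:
  assumes "L > 0" "0 \<le> b" "t > 0"
  shows "(\<integral>s. arc_dome L b (x - t * s) \<partial>cauchy_measure) \<ge> arc_dome L b x - t / L"
proof -
  obtain c where c: "c \<in> arcs b" "arc_dome L b x = dome ((x - c) / L)"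
    using arc_dome_attained[OF assms(2)] .
  have even: "dome (- y) = dome y" for y by (simp add: dome_def)
  have "dome ((c - x) / L) - t / L \<le> (\<integral>s. dome ((c - x) / L + t / L * s) \<partial>cauchy_measure)"
    using assms by (intro dome_average_ge) simp
  also have "\<dots> \<le> (\<integral>s. arc_dome L b (x - t * s) \<partial>cauchy_measure)"
  proof (rule integral_mono)
    show "integrable cauchy_measure (\<lambda>s. dome ((c - x) / L + t / L * s))"
      by (intro integrable_cauchy[where B = 1] continuous_intros) (simp add: abs_dome_le)
    show "integrable cauchy_measure (\<lambda>s. arc_dome L b (x - t * s))"
      using abs_arc_dome_le assms
      by (intro integrable_cauchy[where B = 1] continuous_on_compose2[OF continuous_arc_dome] continuous_intros) auto
    fix s
    have "(c - x) / L + t / L * s = - ((x - t * s - c) / L)"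
      using assms by (simp add: field_simps)
    then show "dome ((c - x) / L + t / L * s) \<le> arc_dome L b (x - t * s)"
      using arc_dome_ge_dome[OF assms(1) c(1), of "x - t * s"] by (simp only: even)
  qed
  finally have "dome ((c - x) / L) - t / L \<le> (\<integral>s. arc_dome L b (x - t * s) \<partial>cauchy_measure)" .
  moreover have "dome ((c - x) / L) = dome ((x - c) / L)"
    using even[of "(x - c) / L"] by (simp add: minus_divide_left)
  ultimately show ?thesis using c(2) by simp
qed

text \<open>The arc itself contributes b. On the rest of the period a nearest point of
  \<open>arcs\<close> is at most b or at least 1, so the function is bounded by two domes centred at
  b and 1, each contributing at most a quarter ellipse.\<close>

lemma integral_arc_dome_le:
  assumes "L > 0" "0 \<le> b" "b \<le> 1"
  shows "integral {0..1} (arc_dome L b) \<le> b + pi * L / 2"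
proof -
  have int: "arc_dome L b integrable_on {p..q}" for p q
    by (rule integrable_continuous_interval[OF continuous_on_subset[OF continuous_arc_dome]]) (use assms in auto)
  have "integral {0..b} (arc_dome L b) = integral {0..b} (\<lambda>x. 1)"
    by (rule integral_cong) (auto simp: arc_dome_eq_1)
  then have 1: "integral {0..b} (arc_dome L b) = b" using assms by simp
  have "integral {b..1} (arc_dome L b) \<le> integral {b..1} (\<lambda>x. dome ((x - b) / L) + dome ((1 - x) / L))"
  proof (rule integral_le[OF int])
    show "(\<lambda>x. dome ((x - b) / L) + dome ((1 - x) / L)) integrable_on {b..1}"
      by (intro integrable_continuous_interval continuous_intros) (use assms in auto)
    fix x assume x: "x \<in> {b..1}"
    obtain c where c: "c \<in> arcs b" "arc_dome L b x = dome ((x - c) / L)"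
      using arc_dome_attained[OF assms(2)] .
    then obtain n :: int where n: "0 \<le> c - of_int n" "c - of_int n \<le> b"
      by (auto simp: in_arcs_iff)
    show "arc_dome L b x \<le> dome ((x - b) / L) + dome ((1 - x) / L)"
    proof (cases "n \<le> 0")
      case True
      then have "real_of_int n \<le> 0" by simp
      then have "c \<le> b" using n by linarith
      then have "dome ((x - c) / L) \<le> dome ((x - b) / L)"
        using x assms by (intro dome_antimono) (auto simp: divide_right_mono)
      then show ?thesis using c(2) dome_nonneg[of "(1 - x) / L"] by simp
    next
      case False
      then have "real_of_int n \<ge> 1" by simp
      then have "c \<ge> 1" using n by linarith
      then have "dome ((x - c) / L) \<le> dome ((1 - x) / L)"
        using x assms by (intro dome_antimono) (auto simp: divide_right_mono)
      then show ?thesis using c(2) dome_nonneg[of "(x - b) / L"] by simp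
    qed
  qed
  also have "\<dots> = integral {b..1} (\<lambda>x. dome ((x - b) / L)) + integral {b..1} (\<lambda>x. dome ((1 - x) / L))"
    by (intro integral_add integrable_continuous_interval continuous_intros) (use assms in auto)
  also have "integral {b..1} (\<lambda>x. dome ((x - b) / L)) = integral {0..1 - b} (\<lambda>x. dome (x / L))"
    using integral_shift_real_ivl[of 0 "- b" "1 - b" "\<lambda>x. dome (x / L)"] by simp
  also have "integral {b..1} (\<lambda>x. dome ((1 - x) / L)) = integral {0..1 - b} (\<lambda>x. dome (x / L))"
  proof -
    have "integral {b..1} (\<lambda>x. dome ((1 - x) / L)) = integral {-1..-b} (\<lambda>x. dome ((x + 1) / L))"
      using Henstock_Kurzweil_Integration.integral_reflect_real[of 1 b "\<lambda>x. dome ((x + 1) / L)", symmetric]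
        Henstock_Kurzweil_Integration.integral_reflect_real[of "-b" "-1" "\<lambda>x. dome ((x + 1) / L)"]
      by (simp add: add.commute)
    also have "\<dots> = integral {0..1 - b} (\<lambda>x. dome (x / L))"
      using integral_shift_real_ivl[of 0 1 "1 - b" "\<lambda>x. dome (x / L)"] by simp
    finally show ?thesis .
  qed
  finally have "integral {b..1} (arc_dome L b) \<le> pi * L / 2"
    using integral_dome_le[of L "1 - b"] assms by simp
  with 1 show ?thesis
    using Henstock_Kurzweil_Integration.integral_combine[of 0 b 1 "arc_dome L b"] assms int by simp
qed

section \<open>The upper bound\<close>

text \<open>Moving along the circle multiplies z * D by 2 pi i, and the imaginary part of i times a
  number is its real part.\<close>

lemma dv_dtheta_eq:
  assumes "(f has_field_derivative D) (at (of_real r * cis (2 * pi * \<theta>)))"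
  shows "dv_dtheta f r \<theta> = Re (2 * pi * (of_real r * cis (2 * pi * \<theta>) * D))"
proof -
  have "((\<lambda>t. of_real r * cis (2 * pi * t)) has_vector_derivative
      of_real r * (of_real (2 * pi) * (\<i> * cis (2 * pi * \<theta>)))) (at \<theta>)"
    by (auto intro!: derivative_eq_intros simp: has_vector_derivative_def scaleR_conv_of_real)
  from field_vector_diff_chain_at[OF this assms]
  have "((\<lambda>t. f (of_real r * cis (2 * pi * t))) has_vector_derivative
      of_real r * (of_real (2 * pi) * (\<i> * cis (2 * pi * \<theta>))) * D) (at \<theta>)"
    by (simp add: o_def)
  then have "((\<lambda>t. Im (f (of_real r * cis (2 * pi * t)))) has_real_derivative
      Im (of_real r * (of_real (2 * pi) * (\<i> * cis (2 * pi * \<theta>))) * D)) (at \<theta>)"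
    unfolding has_real_derivative_iff_has_vector_derivative
    by (rule bounded_linear.has_vector_derivative[OF bounded_linear_Im])
  then have "dv_dtheta f r \<theta> = Im (of_real r * (of_real (2 * pi) * (\<i> * cis (2 * pi * \<theta>))) * D)"
    unfolding dv_dtheta_def by (rule DERIV_imp_deriv)
  also have "of_real r * (of_real (2 * pi) * (\<i> * cis (2 * pi * \<theta>))) * D =
      \<i> * (2 * pi * (of_real r * cis (2 * pi * \<theta>) * D))"
    by simp
  finally show ?thesis by (simp only: Im_i_times)
qed

text \<open>This frees the hypothesis on the angular derivative from polar coordinates. The range of
  \<open>Arg2pi\<close> matches the half-open range of \<theta> in
  \<open>admissible\<close>.\<close>

lemma tangential_derivative_le:
  fixes z :: complex
  assumes "admissible f H K" "norm z < 1"
  shows "Re (2 * pi * (z * deriv f z)) \<le> K"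
proof -
  define \<theta> where "\<theta> = Arg2pi z / (2 * pi)"
  have z: "of_real (norm z) * cis (2 * pi * \<theta>) = z"
    using Arg2pi_eq[of z] by (simp add: \<theta>_def cis_conv_exp)
  have "0 \<le> \<theta>" "\<theta> < 1"
    using Arg2pi_ge_0[of z] Arg2pi_lt_2pi[of z] by (auto simp: \<theta>_def)
  then have "dv_dtheta f (norm z) \<theta> \<le> K"
    using assms by (auto simp: admissible_def)
  moreover have "(f has_field_derivative deriv f z) (at z)"
    using assms by (intro holomorphic_derivI[of f "ball 0 1"]) (auto simp: admissible_def)
  then have "dv_dtheta f (norm z) \<theta> = Re (2 * pi * (z * deriv f z))"
    using dv_dtheta_eq[of f "deriv f z" "norm z" \<theta>] by (simp only: z)
  ultimately show ?thesis by simp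
qed

lemma circle_drop_le:
  assumes adm: "admissible f H K" and z0: "z0 \<noteq> 0" "norm z0 < 1"
    and "L > 0" and b: "0 \<le> b" "b \<le> 1"
  shows "Im (f z0) - Im (f (z0 * cis (2 * pi * b))) \<le> H / L + pi * L * K / 2"
proof -
  have f: "f holomorphic_on ball 0 1" "f 0 = 0" and "K > 0"
    and fH: "\<And>z. norm z < 1 \<Longrightarrow> Re (f z) \<le> H"
    using adm by (auto simp: admissible_def)
  \<comment> \<open>\<open>E\<close> wraps the real axis with period 1 around the circle through z0,
    starting at z0; moving upwards in the half plane moves inwards in the disc.\<close>
  define E where "E w = z0 * exp (2 * pi * \<i> * w)" for w
  define g where "g w = f (E w)" for w
  define g' where "g' w = deriv f (E w) * (E w * (2 * pi * \<i>))" for w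
  define \<Phi> where "\<Phi> = arc_dome L b"
  note \<Phi> = continuous_arc_dome[OF \<open>L > 0\<close>, of b, folded \<Phi>_def]
    arc_dome_periodic[of L b, folded \<Phi>_def] abs_arc_dome_le[of L b, folded \<Phi>_def]
  define up where "up = {w. Im w \<ge> 0}"
  have E_norm: "norm (E w) \<le> norm z0" if "Im w \<ge> 0" for w
    using that by (simp add: E_def norm_mult mult_left_le)
  then have E_lt: "norm (E w) < 1" if "Im w \<ge> 0" for w
    using that z0 by (meson le_less_trans)
  have E_real: "E (of_real x) = z0 * cis (2 * pi * x)" for x
    by (simp add: E_def cis_conv_exp mult_ac)
  have E_deriv: "(E has_field_derivative E w * (2 * pi * \<i>)) (at w)" for w
    unfolding E_def[abs_def] by (auto intro!: derivative_eq_intros)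
  have g_deriv: "(g has_field_derivative g' w) (at w)" if "Im w \<ge> 0" for w
  proof -
    have "(f has_field_derivative deriv f (E w)) (at (E w))"
      using E_lt[OF that] by (intro holomorphic_derivI[OF f(1)]) auto
    from DERIV_chain2[OF this E_deriv] show ?thesis
      unfolding g_def[abs_def] g'_def .
  qed
  have g_hol: "g holomorphic_on up"
    unfolding holomorphic_on_def up_def
    using g_deriv field_differentiable_at_within field_differentiable_def by blast
  have g_cont: "continuous_on up g"
    by (rule holomorphic_on_imp_continuous_on[OF g_hol])
  have E_cont: "continuous_on up E"
    unfolding E_def[abs_def] by (intro continuous_intros)
  have g'_cont: "continuous_on up g'"
  proof -
    have "continuous_on (ball 0 1) (deriv f)"
      by (intro holomorphic_on_imp_continuous_on holomorphic_deriv f) auto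
    then have "continuous_on up (\<lambda>w. deriv f (E w))"
      by (rule continuous_on_compose2[OF _ E_cont]) (auto simp: up_def E_lt)
    then show ?thesis
      unfolding g'_def[abs_def] by (intro continuous_intros E_cont)
  qed
  have "compact (f ` cball 0 (norm z0))"
    by (intro compact_continuous_image continuous_on_subset[OF holomorphic_on_imp_continuous_on[OF f(1)]])
       (use z0 in auto)
  then have "bounded (f ` cball 0 (norm z0))"
    by (rule compact_imp_bounded)
  then obtain B where B: "\<And>z. norm z \<le> norm z0 \<Longrightarrow> norm (f z) \<le> B"
    unfolding bounded_iff by (metis image_eqI mem_cball_0)
  have g_bound: "norm (g w) \<le> B" if "Im w \<ge> 0" for w
    using B[OF E_norm[OF that]] by (simp add: g_def)
  have real_up: "of_real x \<in> up" for x by (simp add: up_def)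

  define u where "u x = Re (g (of_real x))" for x
  have u_cont: "continuous_on UNIV u"
    unfolding u_def by (intro continuous_intros continuous_on_compose2[OF g_cont]) (auto simp: real_up)
  have u_per: "u (x + 1) = u x" for x
  proof -
    have "cis (2 * pi * (x + 1)) = cis (2 * pi * x)"
      by (simp add: complex_eq_iff distrib_left)
    then show ?thesis by (simp only: u_def g_def E_real)
  qed
  have u_bound: "\<bar>u x\<bar> \<le> B" for x
    using abs_Re_le_cmod[of "g (of_real x)"] g_bound[of "of_real x"] by (simp add: u_def)
  have u_le: "u x \<le> H" for x
    unfolding u_def g_def by (intro fH E_lt) simp
  have u_mean: "(\<integral>x. u x \<partial>unit_interval) = 0"
  proof -
    \<comment> \<open>Rotating by \<open>sgn z0\<close> makes the circle start on the positive axis,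
      as \<open>circle_mean_value\<close> requires; the mean is then f 0 = 0.\<close>
    have "(\<lambda>z. f (sgn z0 * z)) holomorphic_on ball 0 1"
      using f(1) z0
      by (intro holomorphic_on_compose_gen[of "\<lambda>z. sgn z0 * z" "ball 0 1" f "ball 0 1", unfolded o_def] holomorphic_intros)
         (auto simp: norm_mult norm_sgn)
    from circle_mean_value[OF this, of "norm z0"]
    have "((\<lambda>x. f (sgn z0 * (of_real (norm z0) * cis (2 * pi * x)))) has_integral 0) {0..1}"
      using z0 f(2) by simp
    moreover have "sgn z0 * (of_real (norm z0) * y) = z0 * y" for y
      using z0 by (simp add: sgn_eq)
    ultimately have "((\<lambda>x. g (of_real x)) has_integral 0) {0..1}"
      by (simp add: g_def E_real)
    from has_integral_linear[OF this bounded_linear_Re]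
    have "(u has_integral 0) {0..1}" by (simp add: o_def u_def[abs_def])
    then show ?thesis
      using u_cont by (simp add: integral_unit_interval integral_unique)
  qed

  define J where "J y = integral {0..1} (\<lambda>x. \<Phi> x * Re (g (Complex x y)))" for y
  have J_le: "J t - J 0 \<le> t * (H / L)" if "t > 0" for t
  proof -
    let ?P = "\<lambda>x. \<integral>s. \<Phi> (x - t * s) \<partial>cauchy_measure"
    have avg: "(\<integral>s. u (x + t * s) \<partial>cauchy_measure) = Re (g (Complex x t))" for x
    proof -
      have "integrable cauchy_measure (\<lambda>s. g (of_real (x + t * s)))"
        by (intro integrable_cauchy[where B = B] continuous_on_compose2[OF g_cont] continuous_intros g_bound)
           (auto simp: up_def)
      then have "(\<integral>s. u (x + t * s) \<partial>cauchy_measure) = Re (\<integral>s. g (of_real (x + t * s)) \<partial>cauchy_measure)"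
        unfolding u_def by (rule integral_Re)
      also have "(\<integral>s. g (of_real (x + t * s)) \<partial>cauchy_measure) = g (Complex x t)"
        by (rule poisson_half_plane[OF holomorphic_on_subset[OF g_hol] g_cont[unfolded up_def] g_bound that])
           (auto simp: up_def)
      finally show ?thesis .
    qed
    note adj = average_adjoint[OF \<Phi> u_cont u_per u_bound, of t]
    \<comment> \<open>Adjointness against the constant 1 shows that averaging preserves the integral
      of \<Phi>.\<close>
    have adj1: "integrable unit_interval ?P" "(\<integral>x. ?P x \<partial>unit_interval) = (\<integral>x. \<Phi> x \<partial>unit_interval)"
      using average_adjoint[OF \<Phi>, of "\<lambda>_. 1" 1 t] by simp_all
    have iu: "integrable unit_interval u"
      by (rule integrable_unit_interval[OF u_cont u_bound])
    have i\<Phi>: "integrable unit_interval \<Phi>"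
      by (rule integrable_unit_interval[OF \<Phi>(1,3)])
    have i\<Phi>u: "integrable unit_interval (\<lambda>x. \<Phi> x * u x)"
    proof (rule integrable_unit_interval)
      show "continuous_on UNIV (\<lambda>x. \<Phi> x * u x)" by (intro continuous_intros \<Phi> u_cont)
      show "\<bar>\<Phi> x * u x\<bar> \<le> 1 * B" for x
        unfolding abs_mult by (intro mult_mono \<Phi> u_bound) auto
    qed
    have cont_up: "continuous_on UNIV (\<lambda>x. \<Phi> x * Re (g (Complex x y)))" if "y \<ge> 0" for y
      unfolding Complex_eq
      by (intro continuous_intros \<Phi> continuous_on_compose2[OF g_cont]) (use that in \<open>auto simp: up_def\<close>)
    have const: "(\<integral>x. c \<partial>unit_interval) = c" "integrable unit_interval (\<lambda>x. c)" for c :: real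
      using integral_unit_interval[of "\<lambda>_. c"] integrable_unit_interval[of "\<lambda>_. c" "\<bar>c\<bar>"] by simp_all
    have "J t - J 0 = (\<integral>x. \<Phi> x * Re (g (Complex x t)) \<partial>unit_interval) - (\<integral>x. \<Phi> x * u x \<partial>unit_interval)"
      using integral_unit_interval[OF cont_up[of t]] integral_unit_interval[OF cont_up[of 0]] that
      by (simp add: J_def u_def complex_of_real_def)
    \<comment> \<open>Adding a multiple of the zero mean of \<open>u\<close> changes nothing but
      makes the weight \<open>?P x - \<Phi> x + t / L\<close> nonnegative, so that the one-sided
      bound \<open>u_le\<close> can be used.\<close>
    also have "\<dots> = (\<integral>x. ?P x * u x \<partial>unit_interval) - (\<integral>x. \<Phi> x * u x \<partial>unit_interval) + t / L * (\<integral>x. u x \<partial>unit_interval)"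
      unfolding adj(2) avg u_mean by simp
    also have "\<dots> = (\<integral>x. ?P x * u x - \<Phi> x * u x + t / L * u x \<partial>unit_interval)"
      using adj(1) i\<Phi>u iu by simp
    also have "\<dots> \<le> (\<integral>x. (?P x - \<Phi> x + t / L) * H \<partial>unit_interval)"
    proof (rule integral_mono)
      show "integrable unit_interval (\<lambda>x. ?P x * u x - \<Phi> x * u x + t / L * u x)"
        using adj(1) i\<Phi>u iu by simp
      show "integrable unit_interval (\<lambda>x. (?P x - \<Phi> x + t / L) * H)"
        using adj1(1) i\<Phi> const(2) by (intro integrable_mult_left integrable_add integrable_diff) auto
      fix x
      have "?P x - \<Phi> x + t / L \<ge> 0"
        using arc_dome_average_ge[OF \<open>L > 0\<close> b(1) that, of x] by (simp add: \<Phi>_def)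
      then have "(?P x - \<Phi> x + t / L) * u x \<le> (?P x - \<Phi> x + t / L) * H"
        by (intro mult_left_mono u_le)
      then show "?P x * u x - \<Phi> x * u x + t / L * u x \<le> (?P x - \<Phi> x + t / L) * H"
        by (simp add: algebra_simps)
    qed
    also have "\<dots> = ((\<integral>x. ?P x \<partial>unit_interval) - (\<integral>x. \<Phi> x \<partial>unit_interval) + t / L) * H"
      using adj1(1) i\<Phi> const by simp
    also have "\<dots> = t * (H / L)"
      using adj1(2) by simp
    finally show ?thesis .
  qed

  define w where "w x = Im (g' (of_real x))" for x
  have w_cont: "continuous_on UNIV w"
    unfolding w_def by (intro continuous_intros continuous_on_compose2[OF g'_cont]) (auto simp: real_up)
  have w_le: "w x \<le> K" for x
  proof -
    have "g' (of_real x) = \<i> * (2 * pi * (E (of_real x) * deriv f (E (of_real x))))"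
      by (simp add: g'_def)
    then have "w x = Re (2 * pi * (E (of_real x) * deriv f (E (of_real x))))"
      by (simp only: w_def Im_i_times)
    then show ?thesis
      using tangential_derivative_le[OF adm E_lt[of "of_real x"]] by simp
  qed
  \<comment> \<open>The vertical derivative of Re g is Re (i g') = - Im g', and Im g' is the
    derivative of v along the circle. The derivative at 0 is one-sided because g is controlled only
    for Im w \<ge> 0.\<close>
  have "(J has_real_derivative integral {0..1} (\<lambda>x. \<Phi> x * Re (\<i> * g' (Complex x 0)))) (at 0 within {0..1})"
    unfolding J_def[abs_def] box_real[symmetric]
  proof (rule leibniz_rule_field_derivative)
    fix y x :: real assume "y \<in> cbox 0 1"
    then have y: "y \<ge> 0" by simp
    have "((\<lambda>y. Complex x y) has_vector_derivative \<i>) (at y)"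
      unfolding Complex_eq by (auto intro!: derivative_eq_intros simp: has_vector_derivative_def scaleR_conv_of_real)
    from field_vector_diff_chain_at[OF this g_deriv] y
    have "((\<lambda>y. g (Complex x y)) has_vector_derivative \<i> * g' (Complex x y)) (at y)"
      by (simp add: o_def)
    from bounded_linear.has_vector_derivative[OF bounded_linear_Re this]
    have "((\<lambda>y. Re (g (Complex x y))) has_real_derivative Re (\<i> * g' (Complex x y))) (at y)"
      by (simp add: has_real_derivative_iff_has_vector_derivative)
    then show "((\<lambda>y. \<Phi> x * Re (g (Complex x y))) has_real_derivative \<Phi> x * Re (\<i> * g' (Complex x y))) (at y within cbox 0 1)"
      by (intro DERIV_cmult) (rule has_field_derivative_at_within)
  next
    fix y :: real assume "y \<in> cbox 0 1"
    then show "(\<lambda>x. \<Phi> x * Re (g (Complex x y))) integrable_on cbox 0 1"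
      unfolding Complex_eq
      by (intro integrable_continuous continuous_intros continuous_on_subset[OF \<Phi>(1)] continuous_on_compose2[OF g_cont])
         (auto simp: up_def)
  next
    show "continuous_on (cbox 0 1 \<times> cbox 0 1) (\<lambda>(y, x). \<Phi> x * Re (\<i> * g' (Complex x y)))"
      unfolding Complex_eq case_prod_unfold
      by (intro continuous_intros continuous_on_compose2[OF \<Phi>(1)] continuous_on_compose2[OF g'_cont])
         (auto simp: up_def)
  qed auto
  also have "(\<lambda>x. \<Phi> x * Re (\<i> * g' (Complex x 0))) = (\<lambda>x. - (\<Phi> x * w x))"
    by (simp add: w_def complex_of_real_def fun_eq_iff)
  finally have "((\<lambda>t. (J t - J 0) / (t - 0)) \<longlongrightarrow> integral {0..1} (\<lambda>x. - (\<Phi> x * w x))) (at 0 within {0..1})"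
    by (simp add: has_field_derivative_iff)
  moreover have "eventually (\<lambda>t. (J t - J 0) / (t - 0) \<le> H / L) (at 0 within {0..1})"
    unfolding eventually_at_filter
    by (intro always_eventually allI impI) (use J_le in \<open>auto simp: divide_le_eq mult.commute less_le\<close>)
  moreover have "at (0::real) within {0..1} \<noteq> bot"
    by (simp add: trivial_limit_within islimpt_Icc)
  ultimately have "integral {0..1} (\<lambda>x. - (\<Phi> x * w x)) \<le> H / L"
    by (intro tendsto_upperbound)

  have int: "h integrable_on {p..q}" if "continuous_on UNIV h" for h :: "real \<Rightarrow> real" and p q
    by (rule integrable_continuous_interval[OF continuous_on_subset[OF that]]) auto
  have c1: "continuous_on UNIV (\<lambda>x. \<Phi> x * (K - w x))" by (intro continuous_intros \<Phi> w_cont)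
  \<comment> \<open>Since K - w is nonnegative, its \<Phi>-weighted integral over the arc is at most
    that over the whole period. The arc gives b K plus the drop of v, and b K cancels against the
    flat part of \<Phi>.\<close>
  have "integral {0..b} (\<lambda>x. \<Phi> x * (K - w x)) = integral {0..b} (\<lambda>x. K - w x)"
    by (rule Henstock_Kurzweil_Integration.integral_cong) (simp add: \<Phi>_def arc_dome_eq_1)
  also have "\<dots> = integral {0..b} (\<lambda>x. K) - integral {0..b} w"
    by (intro Henstock_Kurzweil_Integration.integral_diff int w_cont) auto
  also have "integral {0..b} w = Im (f (z0 * cis (2 * pi * b))) - Im (f z0)"
  proof -
    have "((\<lambda>x. w x) has_integral Im (g (of_real b)) - Im (g (of_real 0))) {0..b}"
    proof (rule fundamental_theorem_of_calculus[OF b(1)])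
      fix x
      have "(of_real has_vector_derivative 1) (at x)"
        by (auto intro!: derivative_eq_intros simp: has_vector_derivative_def scaleR_conv_of_real)
      from field_vector_diff_chain_at[OF this g_deriv]
      have "((\<lambda>x. g (of_real x)) has_vector_derivative g' (of_real x)) (at x)"
        by (simp add: o_def)
      from bounded_linear.has_vector_derivative[OF bounded_linear_Im this]
      show "((\<lambda>x. Im (g (of_real x))) has_vector_derivative w x) (at x within {0..b})"
        unfolding w_def by (rule has_vector_derivative_at_within)
    qed
    then show ?thesis
      by (simp add: integral_unique g_def E_real del: of_real_0)
  qed
  finally have part1: "integral {0..b} (\<lambda>x. \<Phi> x * (K - w x)) =
      b * K - (Im (f (z0 * cis (2 * pi * b))) - Im (f z0))"
    using b by simp
  have part2: "integral {b..1} (\<lambda>x. \<Phi> x * (K - w x)) \<ge> 0"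
    by (intro integral_nonneg int c1) (use w_le in \<open>auto simp: \<Phi>_def arc_dome_nonneg\<close>)
  have "integral {0..1} (\<lambda>x. \<Phi> x * (K - w x)) = integral {0..1} (\<lambda>x. K * \<Phi> x + - (\<Phi> x * w x))"
    by (simp add: algebra_simps)
  also have "\<dots> = K * integral {0..1} \<Phi> + integral {0..1} (\<lambda>x. - (\<Phi> x * w x))"
    by (subst Henstock_Kurzweil_Integration.integral_add) (auto intro!: int continuous_intros \<Phi> w_cont)
  also have "\<dots> \<le> K * (b + pi * L / 2) + H / L"
    using \<open>K > 0\<close> integral_arc_dome_le[OF \<open>L > 0\<close> b] \<open>integral {0..1} (\<lambda>x. - (\<Phi> x * w x)) \<le> H / L\<close>
    by (intro add_mono mult_left_mono) (auto simp: \<Phi>_def)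
  finally have "b * K - (Im (f (z0 * cis (2 * pi * b))) - Im (f z0)) \<le> K * (b + pi * L / 2) + H / L"
    using Henstock_Kurzweil_Integration.integral_combine[OF b int[OF c1]] part1 part2 by simp
  then show ?thesis by (simp add: algebra_simps)
qed

text \<open>By the maximum principle for the real parts of -i f and i f, the extremes of v on a
  closed disc containing both points are found on its boundary circle. The counterclockwise arc from
  the maximum \<open>p\<close> to the minimum \<open>q\<close> then reduces the claim to
  \<open>circle_drop_le\<close>.\<close>

lemma oscillation_le:
  assumes adm: "admissible f H K" and z: "norm z1 < 1" "norm z2 < 1"
  shows "Im (f z1) - Im (f z2) \<le> sqrt (2 * pi) * sqrt (H * K)"
proof -
  have f: "f holomorphic_on ball 0 1" and HK: "H > 0" "K > 0"
    using adm by (auto simp: admissible_def)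
  define r where "r = (1 + max (norm z1) (norm z2)) / 2"
  have r: "norm z1 < r" "norm z2 < r" "r < 1" "r > 0"
    using z by (auto simp: r_def max_def add_pos_nonneg)
  have f_cont: "continuous_on (cball 0 r) f"
    by (rule holomorphic_on_imp_continuous_on[OF holomorphic_on_subset[OF f]]) (use r in auto)
  have cont: "continuous_on (sphere 0 r) (\<lambda>z. Im (f z))"
    by (intro continuous_intros continuous_on_subset[OF f_cont]) auto
  have ne: "sphere (0::complex) r \<noteq> {}" using r by simp
  have max_principle: "Re (c * f z) \<le> M"
    if "norm z < r" "\<And>\<zeta>. norm \<zeta> = r \<Longrightarrow> Re (c * f \<zeta>) \<le> M" for c z M
  proof (rule maximum_real_frontier[of "\<lambda>z. c * f z" "cball 0 r"])
    show "(\<lambda>z. c * f z) holomorphic_on interior (cball 0 r)"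
      by (intro holomorphic_intros holomorphic_on_subset[OF f]) (use r in auto)
    show "continuous_on (closure (cball 0 r)) (\<lambda>z. c * f z)"
      by (simp add: continuous_intros f_cont)
  qed (use that in auto)
  obtain p where p: "norm p = r" "\<And>\<zeta>. norm \<zeta> = r \<Longrightarrow> Im (f \<zeta>) \<le> Im (f p)"
    using continuous_attains_sup[OF compact_sphere ne cont] by auto
  obtain q where q: "norm q = r" "\<And>\<zeta>. norm \<zeta> = r \<Longrightarrow> Im (f q) \<le> Im (f \<zeta>)"
    using continuous_attains_inf[OF compact_sphere ne cont] by auto
  have "Im (f z1) \<le> Im (f p)"
    using max_principle[of z1 "- \<i>" "Im (f p)"] r p(2) by simp
  moreover have "Im (f q) \<le> Im (f z2)"
    using max_principle[of z2 "\<i>" "- Im (f q)"] r q(2) by simp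
  moreover have "Im (f p) - Im (f q) \<le> sqrt (2 * pi) * sqrt (H * K)"
  proof -
    define b where "b = Arg2pi (q / p) / (2 * pi)"
    have p0: "p \<noteq> 0" "norm p < 1" using p r by auto
    have b: "0 \<le> b" "b \<le> 1"
      using Arg2pi_ge_0[of "q / p"] Arg2pi_lt_2pi[of "q / p"] by (auto simp: b_def)
    have "norm (q / p) = 1" using p q r by (simp add: norm_divide)
    then have "cis (2 * pi * b) = q / p"
      using Arg2pi_eq[of "q / p"] by (simp add: b_def cis_conv_exp)
    then have q_eq: "p * cis (2 * pi * b) = q" using p0 by simp
    \<comment> \<open>This L makes the two terms H / L and pi * L * K / 2 equal, which minimises
      their sum.\<close>
    define L where "L = sqrt (2 * H / (pi * K))"
    have L: "L > 0" "L\<^sup>2 = 2 * H / (pi * K)" using HK by (auto simp: L_def)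
    have "H / L + pi * L * K / 2 = pi * K * L"
    proof -
      have "H = pi * K * L\<^sup>2 / 2" using L(2) HK by simp
      then show ?thesis using L(1) by (simp add: power2_eq_square field_simps)
    qed
    also have "\<dots> = sqrt ((pi * K)\<^sup>2 * L\<^sup>2)"
      using HK L(1) by (simp add: real_sqrt_mult)
    also have "(pi * K)\<^sup>2 * L\<^sup>2 = (2 * pi) * (H * K)"
      unfolding L(2) using HK by (simp add: power2_eq_square)
    finally have "H / L + pi * L * K / 2 = sqrt (2 * pi) * sqrt (H * K)"
      by (simp only: real_sqrt_mult)
    then show ?thesis
      using circle_drop_le[OF adm p0 L(1) b] by (simp add: q_eq)
  qed
  ultimately show ?thesis by linarith
qed

section \<open>Sharpness of the constant\<close>

definition sqrt1p :: "complex \<Rightarrow> complex" where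
  "sqrt1p Q = csqrt (1 + Q\<^sup>2)"

text \<open>With \<open>Q = sinh w\<close> this is \<open>tanh (w / 2) - w\<close> on the half strip \<open>Re w > 0\<close>, \<open>\<bar>Im w\<bar> < pi / 2\<close>.\<close>

definition half_strip_map :: "complex \<Rightarrow> complex" where
  "half_strip_map Q = Q / (1 + sqrt1p Q) - Ln (Q + sqrt1p Q)"

lemma power2_sqrt1p: "(sqrt1p Q)\<^sup>2 = 1 + Q\<^sup>2"
  by (simp add: sqrt1p_def)

text \<open>This keeps the argument of \<open>csqrt\<close> off its cut, so \<open>sqrt1p\<close> is
  holomorphic with positive real part on the right half plane.\<close>

lemma one_plus_square_notin_nonpos:
  assumes "Re Q > 0"
  shows "1 + Q\<^sup>2 \<notin> \<real>\<^sub>\<le>\<^sub>0"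
proof
  assume "1 + Q\<^sup>2 \<in> \<real>\<^sub>\<le>\<^sub>0"
  then have "Im (1 + Q\<^sup>2) = 0" "Re (1 + Q\<^sup>2) \<le> 0"
    by (auto simp: complex_nonpos_Reals_iff)
  then have "Im Q = 0" "1 + (Re Q)\<^sup>2 - (Im Q)\<^sup>2 \<le> 0"
    using assms by (auto simp: power2_eq_square)
  then show False
    using zero_le_power2[of "Re Q"] by simp
qed

lemma Re_sqrt1p_pos:
  assumes "Re Q > 0"
  shows "Re (sqrt1p Q) > 0"
proof (rule ccontr)
  assume "\<not> Re (sqrt1p Q) > 0"
  then have "Re (sqrt1p Q) = 0"
    using Re_csqrt[of "1 + Q\<^sup>2"] by (simp add: sqrt1p_def)
  then have "1 + Q\<^sup>2 = of_real (- (Im (sqrt1p Q))\<^sup>2)"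
    unfolding power2_sqrt1p[symmetric] by (simp add: complex_eq_iff power2_eq_square)
  also have "\<dots> \<in> \<real>\<^sub>\<le>\<^sub>0"
    by (simp only: nonpos_Reals_of_real_iff) simp
  finally show False
    using one_plus_square_notin_nonpos[OF assms] by simp
qed

lemma sqrt1p_eqI: "Re S > 0 \<Longrightarrow> S\<^sup>2 = 1 + Q\<^sup>2 \<Longrightarrow> sqrt1p Q = S"
  unfolding sqrt1p_def by (rule csqrt_unique) auto

text \<open>With S = \<open>sqrt1p Q\<close>, the quotient differentiates to 1 / (S (1 + S)) and the
  logarithm to 1 / S, both by S^2 = 1 + Q^2; in the difference the factor S cancels.\<close>

lemma half_strip_map_deriv:
  assumes "Re Q > 0"
  shows "(half_strip_map has_field_derivative - 1 / (1 + sqrt1p Q)) (at Q)"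
proof -
  define S where "S = sqrt1p Q"
  have S: "Re S > 0" "S\<^sup>2 = 1 + Q\<^sup>2"
    using Re_sqrt1p_pos[OF assms] power2_sqrt1p by (auto simp: S_def)
  have nz: "S \<noteq> 0" "1 + S \<noteq> 0" "Q + S \<noteq> 0"
    using S(1) assms by (auto simp: complex_eq_iff)
  have np: "Q + S \<notin> \<real>\<^sub>\<le>\<^sub>0"
    using S(1) assms by (auto simp: complex_nonpos_Reals_iff)
  have dS: "(sqrt1p has_field_derivative Q / S) (at Q)"
    unfolding sqrt1p_def[abs_def]
    using one_plus_square_notin_nonpos[OF assms]
    by (auto intro!: derivative_eq_intros simp: S_def sqrt1p_def)
  have "(half_strip_map has_field_derivative
      (1 * (1 + S) - Q * (Q / S)) / ((1 + S) * (1 + S)) - (1 + Q / S) / (Q + S)) (at Q)"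
    unfolding half_strip_map_def[abs_def]
  proof (rule DERIV_diff)
    have "((\<lambda>Q. 1 + sqrt1p Q) has_field_derivative Q / S) (at Q)"
      using DERIV_add[OF DERIV_const dS] by simp
    from DERIV_divide[OF DERIV_ident this]
    show "((\<lambda>Q. Q / (1 + sqrt1p Q)) has_field_derivative
        (1 * (1 + S) - Q * (Q / S)) / ((1 + S) * (1 + S))) (at Q)"
      using nz by (simp add: S_def)
    have "((\<lambda>Q. Q + sqrt1p Q) has_field_derivative 1 + Q / S) (at Q)"
      by (intro DERIV_add DERIV_ident dS)
    moreover have "(Ln has_field_derivative inverse (Q + S)) (at (Q + sqrt1p Q))"
      using has_field_derivative_Ln[OF np] by (simp add: S_def)
    ultimately have "((\<lambda>Q. Ln (Q + sqrt1p Q)) has_field_derivative inverse (Q + S) * (1 + Q / S)) (at Q)"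
      by (rule DERIV_chain2[rotated])
    then show "((\<lambda>Q. Ln (Q + sqrt1p Q)) has_field_derivative (1 + Q / S) / (Q + S)) (at Q)"
      by (simp only: divide_inverse mult.commute)
  qed
  moreover have "(1 + Q / S) / (Q + S) = 1 / S"
    using nz by (simp add: divide_simps)
  moreover have "(1 * (1 + S) - Q * (Q / S)) / ((1 + S) * (1 + S)) = 1 / (S * (1 + S))"
  proof -
    have "Q * (Q / S) = (S\<^sup>2 - 1) / S"
      using S(2) by (simp add: power2_eq_square)
    then have "1 * (1 + S) - Q * (Q / S) = (1 + S) / S"
      using nz by (simp add: divide_simps power2_eq_square) (simp add: algebra_simps)
    then show ?thesis using nz by simp
  qed
  moreover have "1 / (S * (1 + S)) - 1 / S = - 1 / (1 + S)"
    using nz by (simp add: divide_simps)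
  ultimately show ?thesis by (simp add: S_def)
qed

text \<open>This is x \<le> artanh x in logarithmic form: the difference of the two sides vanishes
  at 0 and has derivative 2 y^2 / (1 - y^2).\<close>

lemma le_artanh:
  fixes x :: real
  assumes "0 \<le> x" "x < 1"
  shows "2 * x \<le> ln ((1 + x) / (1 - x))"
proof -
  have "(\<lambda>y. ln (1 + y) - ln (1 - y) - 2 * y) 0 \<le> (\<lambda>y. ln (1 + y) - ln (1 - y) - 2 * y) x"
  proof (rule DERIV_nonneg_imp_nondecreasing[OF assms(1)])
    fix y assume y: "0 \<le> y" "y \<le> x"
    have y2: "y < 1" "y\<^sup>2 < 1"
      using y assms by (auto simp: power_less_one_iff abs_square_less_1)
    have "((\<lambda>y. ln (1 + y) - ln (1 - y) - 2 * y) has_real_derivative 1 / (1 + y) + 1 / (1 - y) - 2) (at y)"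
      using y y2 by (auto intro!: derivative_eq_intros simp: divide_simps)
    moreover have "1 / (1 + y) + 1 / (1 - y) - 2 = 2 * y\<^sup>2 / (1 - y\<^sup>2)"
    proof -
      have "1 / (1 + y) + 1 / (1 - y) = 2 / ((1 + y) * (1 - y))"
        using y y2 by (simp add: divide_simps)
      also have "(1 + y) * (1 - y) = 1 - y\<^sup>2"
        by (simp add: power2_eq_square algebra_simps)
      finally show ?thesis
        using y2 by (simp add: field_simps)
    qed
    moreover have "2 * y\<^sup>2 / (1 - y\<^sup>2) \<ge> 0"
      using y2 by simp
    ultimately show "\<exists>D. ((\<lambda>y. ln (1 + y) - ln (1 - y) - 2 * y) has_real_derivative D) (at y) \<and> 0 \<le> D"
      by auto
  qed
  then show ?thesis
    using assms by (simp add: ln_div)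
qed

text \<open>Here \<tau> is tanh (w / 2), and Q + S = (1 + \<tau>) / (1 - \<tau>), so the claim
  compares Re \<tau> with the log of the modulus of that quotient. The number \<open>x\<close> is
  chosen so that the squared modulus is exactly (1 + x) / (1 - x); then Re \<tau> \<le> x, and
  \<open>le_artanh\<close> finishes.\<close>

lemma Re_half_strip_map_nonpos:
  assumes "Re Q > 0"
  shows "Re (half_strip_map Q) \<le> 0"
proof -
  define S where "S = sqrt1p Q"
  have S: "Re S > 0" "S\<^sup>2 = 1 + Q\<^sup>2"
    using Re_sqrt1p_pos[OF assms] power2_sqrt1p by (auto simp: S_def)
  have nz: "1 + S \<noteq> 0" "Q + S \<noteq> 0"
    using S(1) assms by (auto simp: complex_eq_iff)
  define \<tau> where "\<tau> = Q / (1 + S)"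
  define N where "N = (norm \<tau>)\<^sup>2"
  have eq: "(Q + S) * (1 - \<tau>) = 1 + \<tau>"
  proof -
    have "(Q + S) * (1 + S - Q) = 1 + S + Q"
      using S(2) by (simp add: algebra_simps power2_eq_square)
    then show ?thesis using nz unfolding \<tau>_def by (simp add: divide_simps)
  qed
  have "Re \<tau> \<ge> 0"
  proof -
    have im: "Re S * Im S = Re Q * Im Q"
      using S(2) by (auto simp: complex_eq_iff power2_eq_square mult.commute)
    have "Im S * Im Q \<ge> 0"
    proof -
      have "Re S * (Im S * Im Q) = Re Q * (Im Q)\<^sup>2"
        using im by (metis mult.assoc power2_eq_square)
      also have "\<dots> \<ge> 0" using assms by simp
      finally show ?thesis using S(1) by (simp add: zero_le_mult_iff)
    qed
    moreover have "Re Q * (1 + Re S) \<ge> 0" using assms S by simp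
    ultimately show ?thesis
      unfolding \<tau>_def Re_divide by (auto intro!: divide_nonneg_nonneg simp: algebra_simps)
  qed
  \<comment> \<open>From Q^2 = (S - 1)(S + 1) and |S - 1| < |S + 1| follows |Q| < |S + 1|.\<close>
  have "norm \<tau> < 1"
  proof -
    have "norm (S - 1) < norm (S + 1)"
      using S(1) by (simp add: cmod_def power2_eq_square algebra_simps)
    moreover have "norm Q * norm Q = norm (S - 1) * norm (S + 1)"
    proof -
      have "Q * Q = (S - 1) * (S + 1)"
        using S(2) by (simp add: algebra_simps power2_eq_square)
      then show ?thesis by (metis norm_mult)
    qed
    ultimately have "norm Q * norm Q < norm (S + 1) * norm (S + 1)"
      using nz by (simp add: add.commute)
    then have "norm Q < norm (S + 1)"
      using mult_mono[of "norm (S + 1)" "norm Q" "norm (S + 1)" "norm Q"] by force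
    then show ?thesis
      unfolding \<tau>_def using nz by (simp add: norm_divide add.commute)
  qed
  have N: "0 \<le> N" "N < 1" "1 + N > 0"
    using \<open>norm \<tau> < 1\<close> by (auto simp: N_def power_less_one_iff add_pos_nonneg)
  define x where "x = 2 * Re \<tau> / (1 + N)"
  have "x \<ge> Re \<tau>"
  proof -
    have "Re \<tau> * (1 + N) \<le> Re \<tau> * 2"
      using \<open>Re \<tau> \<ge> 0\<close> N by (intro mult_left_mono) auto
    then show ?thesis using N by (simp add: x_def field_simps)
  qed
  have n1: "(norm (1 - \<tau>))\<^sup>2 = 1 + N - 2 * Re \<tau>" and n2: "(norm (1 + \<tau>))\<^sup>2 = 1 + N + 2 * Re \<tau>"
    unfolding N_def cmod_power2 by (simp_all add: power2_eq_square algebra_simps)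
  have "1 - \<tau> \<noteq> 0" using \<open>norm \<tau> < 1\<close> by auto
  then have pos: "1 + N - 2 * Re \<tau> > 0"
    unfolding n1[symmetric] by simp
  then have x: "0 \<le> x" "x < 1"
    using N \<open>Re \<tau> \<ge> 0\<close> by (auto simp: x_def field_simps)
  have "(norm (Q + S))\<^sup>2 = (1 + x) / (1 - x)"
  proof -
    have "Q + S = (1 + \<tau>) / (1 - \<tau>)"
      using eq \<open>1 - \<tau> \<noteq> 0\<close> by (simp add: eq_divide_eq)
    then have "(norm (Q + S))\<^sup>2 = (1 + N + 2 * Re \<tau>) / (1 + N - 2 * Re \<tau>)"
      by (simp add: norm_divide power_divide n1 n2)
    also have "\<dots> = (1 + x) / (1 - x)"
    proof -
      have "1 + x = (1 + N + 2 * Re \<tau>) / (1 + N)" "1 - x = (1 + N - 2 * Re \<tau>) / (1 + N)"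
        using N by (simp_all add: x_def field_simps)
      then show ?thesis using N by simp
    qed
    finally show ?thesis .
  qed
  moreover have "ln ((norm (Q + S))\<^sup>2) = 2 * ln (norm (Q + S))"
    using nz by (simp add: ln_realpow)
  ultimately have "x \<le> ln (norm (Q + S))"
    using le_artanh[OF x] by simp
  then show ?thesis
    using \<open>x \<ge> Re \<tau>\<close> nz by (simp add: half_strip_map_def S_def[symmetric] \<tau>_def[symmetric] Re_Ln)
qed

text \<open>In the coordinate w = X + i Y the logarithm is exactly w, so the error is Im tanh (w /
  2) = sin Y / (cosh X + cos Y), which fades as X grows.\<close>

lemma half_strip_map_sinh:
  assumes "\<bar>Y\<bar> < pi / 2" "X > 0"
  defines "Q \<equiv> sinh (Complex X Y)"
  shows "Re Q > 0" "\<bar>Im (half_strip_map Q) + Y\<bar> \<le> 1 / cosh X"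
proof -
  define w where "w = Complex X Y"
  have cosY: "cos Y > 0" using assms by (intro cos_gt_zero_pi) auto
  have sc: "Re (sinh w) = sinh X * cos Y" "Im (sinh w) = cosh X * sin Y"
       "Re (cosh w) = cosh X * cos Y" "Im (cosh w) = sinh X * sin Y"
    by (simp_all add: w_def sinh_def cosh_def Re_exp Im_exp scaleR_conv_of_real field_simps)
  show "Re Q > 0" using cosY assms sc by (simp add: Q_def w_def)
  have S: "sqrt1p Q = cosh w"
    using cosY sc by (intro sqrt1p_eqI) (auto simp: Q_def w_def[symmetric] cosh_square_eq)
  have "Q + sqrt1p Q = exp w"
    unfolding S by (simp add: Q_def w_def[symmetric] sinh_plus_cosh)
  then have "Ln (Q + sqrt1p Q) = w"
    using assms by (simp add: w_def Ln_exp)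
  moreover have "\<bar>Im (sinh w / (1 + cosh w))\<bar> \<le> 1 / cosh X"
  proof -
    have "(norm (1 + cosh w))\<^sup>2 = (cosh X + cos Y)\<^sup>2"
    proof -
      have "(norm (1 + cosh w))\<^sup>2 = (1 + cosh X * cos Y)\<^sup>2 + (sinh X)\<^sup>2 * (sin Y)\<^sup>2"
        by (simp add: cmod_power2 sc power_mult_distrib)
      also have "\<dots> = (1 + cosh X * cos Y)\<^sup>2 + ((cosh X)\<^sup>2 - 1) * (1 - (cos Y)\<^sup>2)"
        by (simp add: sinh_square_eq sin_squared_eq)
      also have "\<dots> = (cosh X + cos Y)\<^sup>2"
        by (simp add: power2_eq_square algebra_simps)
      finally show ?thesis .
    qed
    moreover have "Im (sinh w / (1 + cosh w)) = sin Y * (cosh X + cos Y) / (norm (1 + cosh w))\<^sup>2"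
    proof -
      have "Im (sinh w / (1 + cosh w)) = (cosh X * sin Y * (1 + cosh X * cos Y) - sinh X * cos Y * (sinh X * sin Y)) / (norm (1 + cosh w))\<^sup>2"
        by (simp add: Im_divide sc cmod_power2)
      also have "cosh X * sin Y * (1 + cosh X * cos Y) - sinh X * cos Y * (sinh X * sin Y)
          = sin Y * (cosh X + cos Y * ((cosh X)\<^sup>2 - (sinh X)\<^sup>2))"
        by (simp add: power2_eq_square algebra_simps)
      finally show ?thesis by (simp add: cosh_square_eq)
    qed
    moreover have "cosh X + cos Y > 0" using cosY by (simp add: add_pos_pos)
    ultimately have "\<bar>Im (sinh w / (1 + cosh w))\<bar> = \<bar>sin Y\<bar> / (cosh X + cos Y)"
      by (simp add: power2_eq_square abs_mult)
    also have "\<dots> \<le> 1 / cosh X"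
      using cosY by (intro frac_le) auto
    finally show ?thesis .
  qed
  ultimately show "\<bar>Im (half_strip_map Q) + Y\<bar> \<le> 1 / cosh X"
    unfolding half_strip_map_def S by (simp add: Q_def w_def[symmetric]) (simp add: w_def)
qed

text \<open>This controls the constant subtracted in \<open>near_extremal\<close> and hence H. The
  function x / (1 + R) + x / 2 - arsinh x, with R = sqrt (1 + x^2), vanishes at 0 and has derivative
  (R - 1) / (2 (1 + R)) \<ge> 0.\<close>

lemma half_strip_map_real_ge:
  assumes "s > 0"
  shows "Re (half_strip_map (of_real s)) \<ge> - s / 2"
proof -
  have S: "sqrt1p (of_real x) = of_real (sqrt (1 + x\<^sup>2))" for x
    by (intro sqrt1p_eqI) (auto simp flip: of_real_power simp: add_pos_nonneg)
  have "ln (s + sqrt (1 + s\<^sup>2)) - s / (1 + sqrt (1 + s\<^sup>2)) \<le> s / 2"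
  proof -
    have "(\<lambda>x. x / (1 + sqrt (1 + x\<^sup>2)) + x / 2 - arsinh x) 0 \<le> (\<lambda>x. x / (1 + sqrt (1 + x\<^sup>2)) + x / 2 - arsinh x) s"
    proof (rule DERIV_nonneg_imp_nondecreasing[of 0 s])
      show "0 \<le> s" using assms by simp
      fix x :: real
      define R where "R = sqrt (1 + x\<^sup>2)"
      have p: "1 + x\<^sup>2 > 0" by (simp add: add_pos_nonneg)
      have R: "R\<^sup>2 = 1 + x\<^sup>2" "R \<ge> 1" by (simp_all add: R_def)
      have "((\<lambda>x. x / (1 + sqrt (1 + x\<^sup>2)) + x / 2 - arsinh x) has_real_derivative
          (1 * (1 + R) - x * (x / R)) / ((1 + R) * (1 + R)) + 1 / 2 - 1 / R) (at x)"
      proof (intro DERIV_diff DERIV_add)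
        have "((\<lambda>x. 1 + x\<^sup>2) has_real_derivative 2 * x) (at x)"
          by (auto intro!: derivative_eq_intros)
        from DERIV_add[OF DERIV_const[of 1] DERIV_chain2[OF DERIV_real_sqrt[OF p] this]]
        have "((\<lambda>x. 1 + sqrt (1 + x\<^sup>2)) has_real_derivative x / R) (at x)"
          by (simp add: R_def field_simps)
        moreover have "1 + sqrt (1 + x\<^sup>2) \<noteq> 0"
          using R(2) unfolding R_def by linarith
        ultimately show "((\<lambda>x. x / (1 + sqrt (1 + x\<^sup>2))) has_real_derivative
            (1 * (1 + R) - x * (x / R)) / ((1 + R) * (1 + R))) (at x)"
          using DERIV_divide[OF DERIV_ident] unfolding R_def by blast
        show "((\<lambda>x. x / 2) has_real_derivative 1 / 2) (at x)"
          by (auto intro!: derivative_eq_intros)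
        show "(arsinh has_real_derivative 1 / R) (at x)"
          using arsinh_real_has_field_derivative[of x UNIV] by (simp add: R_def add.commute)
      qed
      moreover have "(1 * (1 + R) - x * (x / R)) / ((1 + R) * (1 + R)) = 1 / (R * (1 + R))"
      proof -
        have "x * (x / R) = (R\<^sup>2 - 1) / R"
          using R by (simp add: power2_eq_square)
        then have "1 * (1 + R) - x * (x / R) = (1 + R) / R"
          using R(2) by (simp add: divide_simps power2_eq_square) (simp add: algebra_simps)
        then show ?thesis using R(2) by simp
      qed
      moreover have "1 / (R * (1 + R)) + 1 / 2 - 1 / R = (R - 1) / (2 * (1 + R))"
        using R(2) by (simp add: divide_simps) (simp add: algebra_simps)
      moreover have "(R - 1) / (2 * (1 + R)) \<ge> 0"
        using R(2) by simp
      ultimately show "\<exists>D. ((\<lambda>x. x / (1 + sqrt (1 + x\<^sup>2)) + x / 2 - arsinh x) has_real_derivative D) (at x) \<and> 0 \<le> D"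
        by auto
    qed
    then show ?thesis by (simp add: arsinh_real_def add.commute)
  qed
  moreover have "Re (half_strip_map (of_real s)) = s / (1 + sqrt (1 + s\<^sup>2)) - ln (s + sqrt (1 + s\<^sup>2))"
  proof -
    have "half_strip_map (of_real s) = of_real (s / (1 + sqrt (1 + s\<^sup>2)) - ln (s + sqrt (1 + s\<^sup>2)))"
      using assms unfolding half_strip_map_def S of_real_add[symmetric]
      by (subst Ln_of_real) (auto simp: add_pos_nonneg)
    then show ?thesis by simp
  qed
  ultimately show ?thesis by simp
qed

section \<open>The near-extremal family on the disc\<close>

definition near_extremal :: "real \<Rightarrow> complex \<Rightarrow> complex" where
  "near_extremal s z =
     of_real (s / pi) * (half_strip_map (of_real s * ((1 + z) / (1 - z))) - half_strip_map (of_real s))"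

text \<open>For q = (1 + z) / (1 - z) one has z q' = (q^2 - 1) / 2, and s^2 q^2 = S^2 - 1; the
  factor 1 + S then divides out of all but the term s^2. The form obtained makes the bound on the
  angular derivative visible.\<close>

lemma near_extremal_deriv:
  fixes z :: complex
  assumes "s > 0" "norm z < 1"
  defines "S \<equiv> sqrt1p (of_real s * ((1 + z) / (1 - z)))"
  obtains D where "(near_extremal s has_field_derivative D) (at z)"
    "2 * pi * (z * D) = 1 - S + of_real (s\<^sup>2) / (1 + S)" "Re S > 0"
proof
  define q where "q = (1 + z) / (1 - z)"
  define D where "D = of_real (s / pi) * (- 1 / (1 + S) * (of_real s * (2 / (1 - z)\<^sup>2)))"
  have nz: "1 - z \<noteq> 0" using assms by auto
  have ReQ: "Re (of_real s * q) > 0"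
    using assms Re_cayley_pos[of z] by (simp add: q_def del: times_divide_eq_right)
  have dq: "((\<lambda>z. of_real s * ((1 + z) / (1 - z))) has_field_derivative of_real s * (2 / (1 - z)\<^sup>2)) (at z)"
    using nz by (auto intro!: derivative_eq_intros simp: power2_eq_square divide_simps) (simp add: algebra_simps)
  show "(near_extremal s has_field_derivative D) (at z)"
    unfolding near_extremal_def[abs_def] D_def S_def
    using DERIV_cmult[OF DERIV_diff[OF DERIV_chain2[OF half_strip_map_deriv[OF ReQ[unfolded q_def]] dq] DERIV_const]]
    unfolding diff_zero .
  show ReS: "Re S > 0" unfolding S_def by (intro Re_sqrt1p_pos ReQ[unfolded q_def])
  then have nz2: "1 + S \<noteq> 0" by (auto simp: complex_eq_iff)
  have "z * (2 / (1 - z)\<^sup>2) = (q\<^sup>2 - 1) / 2"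
    using nz by (simp add: q_def divide_simps) (simp add: power2_eq_square algebra_simps)
  moreover have "2 * pi * (z * D) = - (of_real s)\<^sup>2 * (2 * (z * (2 / (1 - z)\<^sup>2))) / (1 + S)"
    by (simp add: D_def power2_eq_square mult_ac)
  ultimately have "2 * pi * (z * D) = - (of_real s)\<^sup>2 * (q\<^sup>2 - 1) / (1 + S)"
    by simp
  also have "- (of_real s)\<^sup>2 * (q\<^sup>2 - 1) = (1 - S) * (1 + S) + of_real (s\<^sup>2)"
    using power2_sqrt1p[of "of_real s * q"] by (simp add: S_def q_def[symmetric] power2_eq_square algebra_simps)
  finally show "2 * pi * (z * D) = 1 - S + of_real (s\<^sup>2) / (1 + S)"
    using nz2 by (simp add: add_divide_distrib)
qed

text \<open>H is s / pi times the bound s / 2 on the subtracted constant. For K, Re S > 0 gives Re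
  (1 - S) \<le> 1 and |1 + S| \<ge> 1.\<close>

lemma admissible_near_extremal:
  assumes "s > 0"
  shows "admissible (near_extremal s) (s\<^sup>2 / (2 * pi)) (1 + s\<^sup>2)"
  unfolding admissible_def
proof (intro conjI allI impI)
  show "near_extremal s holomorphic_on ball 0 1"
    by (rule holomorphic_onI) (metis near_extremal_deriv assms dist_0_norm field_differentiable_def
        field_differentiable_at_within mem_ball)
  show "near_extremal s 0 = 0" by (simp add: near_extremal_def)
  show "s\<^sup>2 / (2 * pi) > 0" using assms by simp
  show "1 + s\<^sup>2 > 0" by (simp add: add_pos_nonneg)
  fix z :: complex assume z: "norm z < 1"
  have "Re (near_extremal s z) = s / pi * (Re (half_strip_map (of_real s * ((1 + z) / (1 - z)))) - Re (half_strip_map (of_real s)))"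
    by (simp add: near_extremal_def Re_divide_of_real)
  also have "\<dots> \<le> s / pi * (s / 2)"
    using assms half_strip_map_real_ge[OF assms] Re_cayley_pos[OF z]
      Re_half_strip_map_nonpos[of "of_real s * ((1 + z) / (1 - z))"]
    by (intro mult_left_mono) (auto simp del: times_divide_eq_right)
  finally show "Re (near_extremal s z) \<le> s\<^sup>2 / (2 * pi)"
    by (simp add: power2_eq_square)
next
  fix r \<theta> :: real assume r: "0 \<le> r \<and> r < 1 \<and> 0 \<le> \<theta> \<and> \<theta> < 1"
  define z where "z = of_real r * cis (2 * pi * \<theta>)"
  define S where "S = sqrt1p (of_real s * ((1 + z) / (1 - z)))"
  have z: "norm z < 1" using r by (simp add: z_def norm_mult)
  obtain D where D: "(near_extremal s has_field_derivative D) (at z)"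
    "2 * pi * (z * D) = 1 - S + of_real (s\<^sup>2) / (1 + S)" "Re S > 0"
    using near_extremal_deriv[OF assms z] unfolding S_def by blast
  have "dv_dtheta (near_extremal s) r \<theta> = Re (2 * pi * (z * D))"
    using dv_dtheta_eq[OF D(1)[unfolded z_def]] by (simp add: z_def)
  also have "\<dots> \<le> 1 + Re (of_real (s\<^sup>2) / (1 + S))"
    unfolding D(2) using D(3) by simp
  also have "Re (of_real (s\<^sup>2) / (1 + S)) \<le> s\<^sup>2 / norm (1 + S)"
    by (metis complex_Re_le_cmod norm_divide norm_of_real abs_of_nonneg zero_le_power2)
  also have "s\<^sup>2 / norm (1 + S) \<le> s\<^sup>2 / 1"
    using D(3) complex_Re_le_cmod[of "1 + S"] by (intro divide_left_mono) auto
  finally show "dv_dtheta (near_extremal s) r \<theta> \<le> 1 + s\<^sup>2" by simp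
qed

text \<open>Far out in the half strip, near its two horizontal edges, the imaginary part of
  \<open>half_strip_map\<close> is close to -pi / 2 and pi / 2; the factor s / pi turns this gap of
  pi into s.\<close>

lemma near_extremal_oscillation:
  assumes "s > 0" "d < s"
  obtains z1 z2 where "norm z1 < 1" "norm z2 < 1"
    "\<bar>Im (near_extremal s z1) - Im (near_extremal s z2)\<bar> > d"
proof -
  have preimage: "\<exists>z. norm z < 1 \<and> of_real s * ((1 + z) / (1 - z)) = Q" if "Re Q > 0" for Q
  proof -
    define q where "q = Q / of_real s"
    have q: "Re q > 0" using that assms by (simp add: q_def Re_divide_of_real)
    then have nz: "q + 1 \<noteq> 0" by (auto simp: complex_eq_iff)
    have "norm (q - 1) < norm (q + 1)"
      using q by (simp add: cmod_def power2_eq_square algebra_simps)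
    then have "norm ((q - 1) / (q + 1)) < 1"
      using nz by (simp add: norm_divide)
    moreover have "(1 + (q - 1) / (q + 1)) / (1 - (q - 1) / (q + 1)) = q"
    proof -
      have "1 + (q - 1) / (q + 1) = 2 * q / (q + 1)" "1 - (q - 1) / (q + 1) = 2 / (q + 1)"
        using nz by (simp_all add: divide_simps)
      then show ?thesis using nz by simp
    qed
    then have "of_real s * ((1 + (q - 1) / (q + 1)) / (1 - (q - 1) / (q + 1))) = Q"
      using assms by (simp add: q_def)
    ultimately show ?thesis by blast
  qed
  \<comment> \<open>The guaranteed gap is 2 Y - 2 e = pi - 4 e, so 5 e \<le> pi (1 - d / s) leaves
    strict room. The cap at 1 keeps Y inside the strip even for very negative d.\<close>
  define e where "e = min 1 (pi * (1 - d / s) / 5)"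
  have e: "e > 0" "e \<le> 1" "5 * e \<le> pi * (1 - d / s)"
    using assms by (auto simp: e_def min_def field_simps)
  define Y where "Y = pi / 2 - e"
  have Y: "\<bar>Y\<bar> < pi / 2" "\<bar>- Y\<bar> < pi / 2"
    using e pi_gt3 by (auto simp: Y_def)
  have "filterlim (cosh :: real \<Rightarrow> real) at_top at_top"
    by (rule cosh_real_at_top)
  then have "eventually (\<lambda>X. cosh X \<ge> 1 / e \<and> X > 0) at_top"
    by (intro eventually_conj eventually_gt_at_top) (simp add: filterlim_at_top)
  then obtain X where X: "cosh X \<ge> 1 / e" "X > 0"
    using eventually_happens'[OF trivial_limit_at_top_linorder] by blast
  have Xe: "1 / cosh X \<le> e"
    using X e by (simp add: field_simps)
  note P = half_strip_map_sinh[OF Y(1) X(2)] half_strip_map_sinh[OF Y(2) X(2)]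
  obtain z1 where z1: "norm z1 < 1" "of_real s * ((1 + z1) / (1 - z1)) = sinh (Complex X Y)"
    using preimage P(1) by blast
  obtain z2 where z2: "norm z2 < 1" "of_real s * ((1 + z2) / (1 - z2)) = sinh (Complex X (- Y))"
    using preimage P(3) by blast
  have "Im (near_extremal s z2) - Im (near_extremal s z1) =
     s / pi * (Im (half_strip_map (sinh (Complex X (- Y)))) - Im (half_strip_map (sinh (Complex X Y))))"
    unfolding near_extremal_def z1 z2 by (simp add: right_diff_distrib diff_divide_distrib)
  also have "\<dots> \<ge> s / pi * (2 * Y - 2 * e)"
    using P(2,4) Xe assms by (intro mult_left_mono) auto
  finally have "Im (near_extremal s z2) - Im (near_extremal s z1) \<ge> s / pi * (2 * Y - 2 * e)" .
  moreover have "s / pi * (2 * Y - 2 * e) > d"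
  proof -
    have "2 * Y - 2 * e > pi * (d / s)"
      using e by (simp add: Y_def algebra_simps)
    then have "s / pi * (2 * Y - 2 * e) > s / pi * (pi * (d / s))"
      using assms by (intro mult_strict_left_mono) auto
    then show ?thesis using assms by simp
  qed
  ultimately have "\<bar>Im (near_extremal s z1) - Im (near_extremal s z2)\<bar> > d"
    by simp
  with z1 z2 that show ?thesis by blast
qed

text \<open>For this family sqrt (H K) = s sqrt (1 + s^2) / sqrt (2 pi), while the oscillation
  exceeds every number below s. Any s with c sqrt (1 + s^2) < sqrt (2 pi) works, and small s
  qualify.\<close>

lemma sqrt_2pi_sharp:
  assumes "c < sqrt (2 * pi)"
  shows "\<exists>f H K z1 z2. admissible f H K \<and> norm z1 < 1 \<and> norm z2 < 1 \<and>
               \<bar>Im (f z1) - Im (f z2)\<bar> > c * sqrt (H * K)"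
proof -
  have "((\<lambda>s::real. c * sqrt (1 + s\<^sup>2)) \<longlongrightarrow> c * sqrt (1 + 0\<^sup>2)) (at_right 0)"
    by (intro tendsto_intros)
  then have "eventually (\<lambda>s. c * sqrt (1 + s\<^sup>2) < sqrt (2 * pi) \<and> s > 0) (at_right 0)"
    using assms by (intro eventually_conj eventually_at_right_less order_tendstoD(2)) auto
  then obtain s where s: "c * sqrt (1 + s\<^sup>2) < sqrt (2 * pi)" "s > 0"
    using eventually_happens trivial_limit_at_right_real by blast
  have "c * sqrt (s\<^sup>2 / (2 * pi) * (1 + s\<^sup>2)) = s * (c * sqrt (1 + s\<^sup>2) / sqrt (2 * pi))"
    using s(2) by (simp add: real_sqrt_mult real_sqrt_divide)
  also have "\<dots> < s * 1"
    using s by (intro mult_strict_left_mono) auto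
  finally show ?thesis
    using near_extremal_oscillation[OF s(2)] admissible_near_extremal[OF s(2)] by (metis mult.right_neutral)
qed

theorem theorem1p3:
  shows "(\<forall>f H K z1 z2. admissible f H K \<and> norm z1 < 1 \<and> norm z2 < 1 \<longrightarrow>
            \<bar>Im (f z1) - Im (f z2)\<bar> \<le> sqrt (2 * pi) * sqrt (H * K)) \<and>
         (\<forall>c. c < sqrt (2 * pi) \<longrightarrow>
            (\<exists>f H K z1 z2. admissible f H K \<and> norm z1 < 1 \<and> norm z2 < 1 \<and>
               \<bar>Im (f z1) - Im (f z2)\<bar> > c * sqrt (H * K)))"
proof (intro conjI allI impI)
  fix f H K and z1 z2 :: complex
  assume "admissible f H K \<and> norm z1 < 1 \<and> norm z2 < 1"
  then show "\<bar>Im (f z1) - Im (f z2)\<bar> \<le> sqrt (2 * pi) * sqrt (H * K)"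
    using oscillation_le[of f H K z1 z2] oscillation_le[of f H K z2 z1] by (simp add: abs_le_iff)
qed (rule sqrt_2pi_sharp)

end
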